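(* Let $\alpha,\beta$ be real constants with $0\le\beta<2^{-H(\alpha)/\alpha}<\alpha\le1$. Then there exist a rational number $c$ with $0<c<\alpha$ and a constant $C>0$ such that for every $\varepsilon\in(0,1/2]$, every integer $n\ge C\log(1/\varepsilon)$, and every two-outcome verifier $P_0,P_1$ (for any $r$ and any spaces) with single-copy optimal winning probability $p$: if $p\ge\alpha$ then $p'_{n,\lfloor cn\rfloor}\ge1-\varepsilon$, and if $p\le\beta$ then $p'_{n,\lfloor cn\rfloor}\le\varepsilon$. That is, repeating the interaction $n=O(\log(1/\varepsilon))$ times in parallel and accepting iff at least $\lfloor cn\rfloor$ copies accept reduces both the completeness error and the soundness error below $\varepsilon$.
   Context: $H(x)=-x\log_2x-(1-x)\log_2(1-x)$ is the binary entropy (with $H(1)=0$). Fix an integer $r\ge1$ and finite-dimensional complex Hilbert spaces $\mathcal{X}_1,\dots,\mathcal{X}_r$, $\mathcal{Y}_1,\dots,\mathcal{Y}_r$; write $\mathcal{X}_{1\ldots j}=\mathcal{X}_1\otimes\cdots\otimes\mathcal{X}_j$, similarly $\mathcal{Y}_{1\ldots j}$, identifying tensor products in different orders. $\mathrm{Pos}$ = positive semidefinite operators, $\mathrm{D}$ = density operators, $\langle A,B\rangle=\mathrm{Tr}(A^*B)$. A two-outcome verifier (modelling a quantum interactive proof verifier on a fixed input, outcome $1$ = accept) is a pair $P_0,P_1\in\mathrm{Pos}(\mathcal{Y}_{1\ldots r}\otimes\mathcal{X}_{1\ldots r})$ for which there exist $R_1=\rho\in\mathrm{D}(\mathcal{X}_1)$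 and $R_j\in\mathrm{Pos}(\mathcal{Y}_{1\ldots j-1}\otimes\mathcal{X}_{1\ldots j})$, $2\le j\le r$, with $\mathrm{Tr}_{\mathcal{X}_{j+1}}(R_{j+1})=\mathbb{I}_{\mathcal{Y}_j}\otimes R_j$ for $1\le j\le r-1$ and $P_0+P_1=\mathbb{I}_{\mathcal{Y}_r}\otimes R_r$. For $n\ge1$, an $n$-fold prover strategy is $X\in\mathrm{Pos}((\mathcal{Y}_{1\ldots r}\otimes\mathcal{X}_{1\ldots r})^{\otimes n})$ such that there exist $X_j\in\mathrm{Pos}(\mathcal{Y}_{1\ldots j}^{\otimes n}\otimes\mathcal{X}_{1\ldots j}^{\otimes n})$, $1\le j\le r$, with $X_r=X$, $\mathrm{Tr}_{\mathcal{Y}_1^{\otimes n}}(X_1)=\mathbb{I}_{\mathcal{X}_1^{\otimes n}}$, $\mathrm{Tr}_{\mathcal{Y}_j^{\otimes n}}(X_j)=X_{j-1}\otimes\mathbb{I}_{\mathcal{X}_j^{\otimes n}}$ for $2\le j\le r$. With $\Sigma^n_{\ge k}$ the strings in $\{0,1\}^n$ with at least $k$ ones, let $p=\sup\{\langle P_1,X\rangle: X \text{ a 1-fold strategy}\}$ and $p'_{n,k}=\sup\{\sum_{(i_1,\dots,i_n)\in\Sigma^n_{\ge k}}\langle P_{i_1}\otimes\cdots\otimes P_{i_n},X\rangle: X \text{ an } n\text{-fold strategy}\}$. *)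

theory Defs
  imports Complex_Main "HOL-Library.FuncSet"
begin

definition H :: "real \<Rightarrow> real" where
  "H x = (if x = 0 \<or> x = 1 then 0 else - x * log 2 x - (1 - x) * log 2 (1 - x))"

text \<open>A tensor product of finitely many spaces is modelled by a finite set S of register
labels, each register l being \<open>\<complex>^(d l)\<close>.  A basis vector of the product is a
configuration: an element of \<open>PiE S (\<lambda>l. {..<d l})\<close>.  An operator is a matrix indexed by
configurations (only its values on configurations of S matter).  Because registers are
labelled, tensor products in different orders are identified automatically.\<close>

type_synonym 'l op = "('l \<Rightarrow> nat) \<Rightarrow> ('l \<Rightarrow> nat) \<Rightarrow> complex"

definition cfgs :: "('l \<Rightarrow> nat) \<Rightarrow> 'l set \<Rightarrow> ('l \<Rightarrow> nat) set" where
  "cfgs d S = PiE S (\<lambda>l. {..<d l})"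

definition op_eq :: "('l \<Rightarrow> nat) \<Rightarrow> 'l set \<Rightarrow> 'l op \<Rightarrow> 'l op \<Rightarrow> bool" where
  "op_eq d S A B \<longleftrightarrow> (\<forall>a\<in>cfgs d S. \<forall>b\<in>cfgs d S. A a b = B a b)"

definition psd :: "('l \<Rightarrow> nat) \<Rightarrow> 'l set \<Rightarrow> 'l op \<Rightarrow> bool" where
  "psd d S M \<longleftrightarrow> (\<forall>v :: ('l \<Rightarrow> nat) \<Rightarrow> complex.
     let q = (\<Sum>a\<in>cfgs d S. \<Sum>b\<in>cfgs d S. cnj (v a) * M a b * v b) in Im q = 0 \<and> Re q \<ge> 0)"

definition tr :: "('l \<Rightarrow> nat) \<Rightarrow> 'l set \<Rightarrow> 'l op \<Rightarrow> complex" where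
  "tr d S M = (\<Sum>a\<in>cfgs d S. M a a)"

definition density :: "('l \<Rightarrow> nat) \<Rightarrow> 'l set \<Rightarrow> 'l op \<Rightarrow> bool" where
  "density d S M \<longleftrightarrow> psd d S M \<and> tr d S M = 1"

definition idop :: "'l op" where
  "idop a b = (if a = b then 1 else 0)"

text \<open>Tensor product of an operator on S with an operator on T (S, T disjoint).\<close>
definition tensor :: "'l set \<Rightarrow> 'l set \<Rightarrow> 'l op \<Rightarrow> 'l op \<Rightarrow> 'l op" where
  "tensor S T A B a b = A (restrict a S) (restrict b S) * B (restrict a T) (restrict b T)"

definition join :: "('l \<Rightarrow> nat) \<Rightarrow> ('l \<Rightarrow> nat) \<Rightarrow> 'l set \<Rightarrow> ('l \<Rightarrow> nat)" where
  "join a c T = (\<lambda>l. if l \<in> T then c l else a l)"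

definition ptrace :: "('l \<Rightarrow> nat) \<Rightarrow> 'l set \<Rightarrow> 'l op \<Rightarrow> 'l op" where
  "ptrace d T M a b = (\<Sum>c\<in>cfgs d T. M (join a c T) (join b c T))"

definition hs_inner :: "('l \<Rightarrow> nat) \<Rightarrow> 'l set \<Rightarrow> 'l op \<Rightarrow> 'l op \<Rightarrow> complex" where
  "hs_inner d S A B = (\<Sum>a\<in>cfgs d S. \<Sum>b\<in>cfgs d S. cnj (A a b) * B a b)"

definition op_add :: "'l op \<Rightarrow> 'l op \<Rightarrow> 'l op" where
  "op_add A B a b = A a b + B a b"

datatype reg = RX nat | RY nat

definition Xs :: "nat \<Rightarrow> reg set" where "Xs j = RX ` {1..j}"
definition Ys :: "nat \<Rightarrow> reg set" where "Ys j = RY ` {1..j}"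

definition verifier :: "nat \<Rightarrow> (reg \<Rightarrow> nat) \<Rightarrow> reg op \<Rightarrow> reg op \<Rightarrow> bool" where
  "verifier r d P0 P1 \<longleftrightarrow>
     psd d (Ys r \<union> Xs r) P0 \<and> psd d (Ys r \<union> Xs r) P1 \<and>
     (\<exists>R :: nat \<Rightarrow> reg op.
        density d (Xs 1) (R 1) \<and>
        (\<forall>j\<in>{2..r}. psd d (Ys (j - 1) \<union> Xs j) (R j)) \<and>
        (\<forall>j\<in>{1..<r}. op_eq d (Ys j \<union> Xs j)
             (ptrace d {RX (j + 1)} (R (j + 1)))
             (tensor {RY j} (Ys (j - 1) \<union> Xs j) idop (R j))) \<and>
        op_eq d (Ys r \<union> Xs r) (op_add P0 P1)
             (tensor {RY r} (Ys (r - 1) \<union> Xs r) idop (R r)))"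

text \<open>Register (k, l) is register l of copy k < n.\<close>
definition nd :: "(reg \<Rightarrow> nat) \<Rightarrow> (nat \<times> reg \<Rightarrow> nat)" where
  "nd d = (\<lambda>(k, l). d l)"

definition nXs :: "nat \<Rightarrow> nat \<Rightarrow> (nat \<times> reg) set" where "nXs n j = {..<n} \<times> Xs j"
definition nYs :: "nat \<Rightarrow> nat \<Rightarrow> (nat \<times> reg) set" where "nYs n j = {..<n} \<times> Ys j"

definition strategy :: "nat \<Rightarrow> nat \<Rightarrow> (reg \<Rightarrow> nat) \<Rightarrow> (nat \<times> reg) op \<Rightarrow> bool" where
  "strategy n r d X \<longleftrightarrow>
     (\<exists>Xj :: nat \<Rightarrow> (nat \<times> reg) op.
        (\<forall>j\<in>{1..r}. psd (nd d) (nYs n j \<union> nXs n j) (Xj j)) \<and>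
        Xj r = X \<and>
        op_eq (nd d) (nXs n 1) (ptrace (nd d) (nYs n 1) (Xj 1)) idop \<and>
        (\<forall>j\<in>{2..r}. op_eq (nd d) (nYs n (j - 1) \<union> nXs n j)
             (ptrace (nd d) ({..<n} \<times> {RY j}) (Xj j))
             (tensor (nYs n (j - 1) \<union> nXs n (j - 1)) ({..<n} \<times> {RX j}) (Xj (j - 1)) idop)))"

definition prod_op :: "nat \<Rightarrow> reg set \<Rightarrow> (nat \<Rightarrow> reg op) \<Rightarrow> (nat \<Rightarrow> nat) \<Rightarrow> (nat \<times> reg) op" where
  "prod_op n S P i a b = (\<Prod>k<n. P (i k) (restrict (\<lambda>l. a (k, l)) S) (restrict (\<lambda>l. b (k, l)) S))"

definition sel :: "reg op \<Rightarrow> reg op \<Rightarrow> nat \<Rightarrow> reg op" where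
  "sel P0 P1 i = (if i = 0 then P0 else P1)"

definition Sigma_ge :: "nat \<Rightarrow> nat \<Rightarrow> (nat \<Rightarrow> nat) set" where
  "Sigma_ge n k = {i \<in> PiE {..<n} (\<lambda>_. {0, 1}). card {m \<in> {..<n}. i m = 1} \<ge> k}"

text \<open>Optimal single-copy acceptance probability p (a 1-fold strategy lives on copy 0).\<close>
definition p_opt :: "nat \<Rightarrow> (reg \<Rightarrow> nat) \<Rightarrow> reg op \<Rightarrow> reg op \<Rightarrow> real" where
  "p_opt r d P0 P1 = Sup {Re (hs_inner (nd d) (nYs 1 r \<union> nXs 1 r)
        (prod_op 1 (Ys r \<union> Xs r) (sel P0 P1) (\<lambda>_. 1)) X) | X. strategy 1 r d X}"

definition p_rep :: "nat \<Rightarrow> nat \<Rightarrow> nat \<Rightarrow> (reg \<Rightarrow> nat) \<Rightarrow> reg op \<Rightarrow> reg op \<Rightarrow> real" where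
  "p_rep n k r d P0 P1 = Sup {Re (\<Sum>i\<in>Sigma_ge n k. hs_inner (nd d) (nYs n r \<union> nXs n r)
        (prod_op n (Ys r \<union> Xs r) (sel P0 P1) i) X) | X. strategy n r d X}"

end

theory Submission
  imports Defs "HOL-Analysis.Analysis"
begin

text \<open>
  Soundness rests on semidefinite duality for one copy: if every strategy wins with probability less
  than \<open>q\<close>, then \<open>P1\<close> is dominated in the Loewner order by a co-strategy of total trace at most \<open>q\<close>.
  Tensor products of such co-strategies (and of the verifier's own, of trace 1) dominate the
  corresponding products of \<open>P1\<close> and \<open>P0 + P1\<close>, so any fixed set of \<open>k\<close> copies is won with
  probability at most \<open>q^k\<close> by every \<open>n\<close>-fold strategy, and a union bound gives \<open>(n choose k) q^k\<close>.
  With \<open>k\<close> about \<open>c n\<close> this decays exponentially as soon as \<open>q < 2^(-H(c)/c)\<close>, which holds for \<open>c\<close>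
  close to \<open>\<alpha>\<close> by continuity. Completeness is a Chernoff bound for the independent product strategy.

  Duality is needed only up to an arbitrary \<open>\<delta> > 0\<close>. This makes it elementary: over a compact convex
  set, affine equality constraints can be replaced by multipliers one at a time, at a loss of \<open>\<delta>\<close>.
\<close>

section \<open>Positive semidefinite operators\<close>

text \<open>A loss of \<delta> in duality is harmless because both gaps are strict: there is room
  for \<open>b\<close> with \<beta> < b below the critical value and for \<open>q\<close> with c < q
  < \<alpha>. No constraint qualification or attained dual optimum is therefore sought. The obstacle
  is compactness: once the equality constraints are relaxed, the positive operators are unbounded.
  Strategies are truncated to bounded entries first, so the multipliers satisfy the dual constraints
  only approximately and are repaired by multiples of the identity. This is why co-strategies are
  defined by Loewner inequalities: such a repair would destroy equalities, while monotonicity of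
  tensor products of positive operators needs only inequalities. Duality serves two further
  purposes. It shows that a strategy exists at all, so that no supremum is taken over an empty set,
  and it compares 1-fold strategies, which live on registers labelled by copy 0, with strategies on
  the plain registers, without relabelling operators. The critical value 2^(-H(c)/c) is where q^k
  with k = c n balances the number of k-subsets of n copies, about 2^(n H(c)).\<close>

lemma nonneg_Reals_sum:
  "(\<And>x. x \<in> A \<Longrightarrow> f x \<in> \<real>\<^sub>\<ge>\<^sub>0) \<Longrightarrow> (\<Sum>x\<in>A. f x) \<in> (\<real>\<^sub>\<ge>\<^sub>0 :: complex set)"
  by (induction A rule: infinite_finite_induct) auto

text \<open>Vectors supported on two indices reduce Hermitian symmetry and the vanishing of rows to
  2 by 2 blocks.\<close>

lemma nonneg_form_two_points:
  fixes M :: "'a \<Rightarrow> 'a \<Rightarrow> complex"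
  assumes "finite A" "a \<in> A" "c \<in> A" "a \<noteq> c"
    and pos: "\<And>v. (\<Sum>x\<in>A. \<Sum>y\<in>A. cnj (v x) * M x y * v y) \<in> \<real>\<^sub>\<ge>\<^sub>0"
  shows "cnj s * M a a * s + cnj s * M a c * t + cnj t * M c a * s + cnj t * M c c * t \<in> \<real>\<^sub>\<ge>\<^sub>0"
proof -
  define v where "v x = (if x = a then s else if x = c then t else 0)" for x
  have inner: "(\<Sum>y\<in>A. cnj (v x) * M x y * v y) = cnj (v x) * M x a * s + cnj (v x) * M x c * t" for x
  proof -
    have "(\<Sum>y\<in>A. cnj (v x) * M x y * v y) = (\<Sum>y\<in>{a,c}. cnj (v x) * M x y * v y)"
      by (rule sum.mono_neutral_right) (use assms in \<open>auto simp: v_def\<close>)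
    then show ?thesis using assms by (simp add: v_def)
  qed
  have "(\<Sum>x\<in>A. cnj (v x) * M x a * s + cnj (v x) * M x c * t)
      = (\<Sum>x\<in>{a,c}. cnj (v x) * M x a * s + cnj (v x) * M x c * t)"
    by (rule sum.mono_neutral_right) (use assms in \<open>auto simp: v_def\<close>)
  then show ?thesis using pos[of v] assms by (simp add: inner) (simp add: v_def add_ac)
qed

lemma nonneg_form_diag:
  fixes M :: "'a \<Rightarrow> 'a \<Rightarrow> complex"
  assumes "finite A" "a \<in> A"
    and pos: "\<And>v. (\<Sum>x\<in>A. \<Sum>y\<in>A. cnj (v x) * M x y * v y) \<in> \<real>\<^sub>\<ge>\<^sub>0"
  shows "M a a \<in> \<real>\<^sub>\<ge>\<^sub>0"
proof -
  define v where "v x = (if x = a then 1 else 0 :: complex)" for x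
  have "(\<Sum>x\<in>A. \<Sum>y\<in>A. cnj (v x) * M x y * v y) = (\<Sum>x\<in>{a}. \<Sum>y\<in>A. cnj (v x) * M x y * v y)"
    by (rule sum.mono_neutral_right) (use assms in \<open>auto simp: v_def\<close>)
  also have "\<dots> = (\<Sum>x\<in>{a}. \<Sum>y\<in>{a}. cnj (v x) * M x y * v y)"
    by (intro sum.cong refl sum.mono_neutral_right) (use assms in \<open>auto simp: v_def\<close>)
  finally show ?thesis using pos[of v] by (simp add: v_def)
qed

lemma nonneg_form_hermitian:
  fixes M :: "'a \<Rightarrow> 'a \<Rightarrow> complex"
  assumes "finite A" "a \<in> A" "c \<in> A"
    and pos: "\<And>v. (\<Sum>x\<in>A. \<Sum>y\<in>A. cnj (v x) * M x y * v y) \<in> \<real>\<^sub>\<ge>\<^sub>0"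
  shows "M c a = cnj (M a c)"
proof (cases "a = c")
  case True
  then show ?thesis using nonneg_form_diag[OF assms(1,2) pos]
    by (simp add: complex_nonneg_Reals_iff complex_eq_iff)
next
  case False
  note two = nonneg_form_two_points[OF assms(1-3) False pos]
  have "Im (M a a) = 0" "Im (M c c) = 0"
    using nonneg_form_diag[OF assms(1) _ pos] assms(2,3) by (auto simp: complex_nonneg_Reals_iff)
  \<comment> \<open>The vector (1, 1) forces the imaginary parts of \<open>M a c\<close> and
    \<open>M c a\<close> to cancel; the vector (1, i) forces the real parts to agree.\<close>
  then show ?thesis
    using two[of 1 1] two[of 1 \<i>] by (simp add: complex_nonneg_Reals_iff complex_eq_iff)
qed

lemma nonneg_form_zero_row:
  fixes M :: "'a \<Rightarrow> 'a \<Rightarrow> complex"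
  assumes "finite A" "a \<in> A" "c \<in> A"
    and pos: "\<And>v. (\<Sum>x\<in>A. \<Sum>y\<in>A. cnj (v x) * M x y * v y) \<in> \<real>\<^sub>\<ge>\<^sub>0"
    and zero: "M c c = 0"
  shows "M a c = 0"
proof (rule ccontr)
  assume nz: "M a c \<noteq> 0"
  then have ac: "a \<noteq> c" using zero by auto
  have herm: "M c a = cnj (M a c)" by (rule nonneg_form_hermitian[OF assms(1-4)])
  define m where "m = (cmod (M a c))\<^sup>2"
  have m: "m > 0" using nz by (simp add: m_def)
  \<comment> \<open>On the vector with entries 1 and \<open>- l * cnj (M a c)\<close> the form is
    affine in \<open>l\<close>, because \<open>M c c = 0\<close>. This \<open>l\<close> makes its
    real part -1.\<close>
  define l where "l = (Re (M a a) + 1) / (2 * m)"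
  have "Re (M a a - 2 * of_real l * of_real m) \<ge> 0"
  proof -
    have "M a c * cnj (M a c) = of_real m"
      by (simp only: m_def complex_norm_square)
    then have "M a a - 2 * of_real l * of_real m
       = cnj 1 * M a a * 1 + cnj 1 * M a c * (- of_real l * cnj (M a c))
         + cnj (- of_real l * cnj (M a c)) * M c a * 1
         + cnj (- of_real l * cnj (M a c)) * M c c * (- of_real l * cnj (M a c))"
      by (simp add: herm zero algebra_simps)
    then show ?thesis
      using nonneg_form_two_points[OF assms(1-3) ac pos, of 1 "- of_real l * cnj (M a c)"]
      by (simp only: complex_nonneg_Reals_iff)
  qed
  moreover have "2 * l * m = Re (M a a) + 1" using m by (simp add: l_def)
  ultimately show False by simp
qed

text \<open>Cholesky factorisation: peel off one index at a time by a Schur complement.\<close>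

lemma nonneg_form_gram:
  fixes M :: "'a \<Rightarrow> 'a \<Rightarrow> complex"
  assumes "finite A"
    and "\<And>v. (\<Sum>x\<in>A. \<Sum>y\<in>A. cnj (v x) * M x y * v y) \<in> \<real>\<^sub>\<ge>\<^sub>0"
  shows "\<exists>w. \<forall>x\<in>A. \<forall>y\<in>A. M x y = (\<Sum>m\<in>A. w m x * cnj (w m y))"
  using assms
proof (induction A arbitrary: M rule: finite_induct)
  case empty
  then show ?case by simp
next
  case (insert c A)
  note fin = finite.insertI[OF insert.hyps(1), of c]
  note pos = insert.prems
  define x where "x = M c c"
  have xnn: "x \<in> \<real>\<^sub>\<ge>\<^sub>0" unfolding x_def by (rule nonneg_form_diag[OF fin _ pos]) simp
  have herm: "M b a = cnj (M a b)" if "a \<in> insert c A" "b \<in> insert c A" for a b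
    by (rule nonneg_form_hermitian[OF fin that pos])
  have row0: "M a c = 0" if "x = 0" "a \<in> insert c A" for a
    by (rule nonneg_form_zero_row[OF fin that(2) _ pos]) (use that x_def in auto)
  \<comment> \<open>For \<open>x = 0\<close> division by zero returns 0, so \<open>M' = M\<close>;
    this is the right complement, since row and column \<open>c\<close> then vanish by
    \<open>row0\<close>.\<close>
  define M' where "M' a b = M a b - M a c * M c b / x" for a b
  have pos': "(\<Sum>a\<in>A. \<Sum>b\<in>A. cnj (v a) * M' a b * v b) \<in> \<real>\<^sub>\<ge>\<^sub>0" for v
  proof -
    define s where "s = (\<Sum>b\<in>A. M c b * v b)"
    have cs: "(\<Sum>a\<in>A. cnj (v a) * M a c) = cnj s"
      unfolding s_def cnj_sum by (rule sum.cong) (auto simp: herm[of c])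
    have s0: "s = 0" if "x = 0"
      using cs row0[OF that] by simp
    \<comment> \<open>The entry at \<open>c\<close> minimises the form of \<open>M\<close> when the
      others are fixed; the minimum is the form of the Schur complement at \<open>v\<close>.\<close>
    define u where "u = v(c := - s / x)"
    have u: "u a = v a" if "a \<in> A" for a using that insert.hyps by (auto simp: u_def)
    have uc: "u c = - s / x" by (simp add: u_def)
    have cx: "cnj x = x" using xnn by (simp add: complex_nonneg_Reals_iff complex_eq_iff)
    have "(\<Sum>a\<in>insert c A. \<Sum>b\<in>insert c A. cnj (u a) * M a b * u b)
        = cnj (u c) * x * u c + cnj (u c) * s + cnj s * u c + (\<Sum>a\<in>A. \<Sum>b\<in>A. cnj (v a) * M a b * v b)"
    proof -
      have "(\<Sum>b\<in>A. cnj (u c) * M c b * u b) = cnj (u c) * s"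
        unfolding s_def by (simp add: u sum_distrib_left mult.assoc)
      moreover have "(\<Sum>a\<in>A. cnj (u a) * M a c * u c) = cnj s * u c"
        unfolding cs[symmetric] by (simp add: u sum_distrib_right)
      moreover have "(\<Sum>a\<in>A. \<Sum>b\<in>A. cnj (u a) * M a b * u b) = (\<Sum>a\<in>A. \<Sum>b\<in>A. cnj (v a) * M a b * v b)"
        by (simp add: u)
      ultimately show ?thesis
        using insert.hyps by (simp add: sum.distrib x_def)
    qed
    also have "\<dots> = (\<Sum>a\<in>A. \<Sum>b\<in>A. cnj (v a) * M a b * v b) - cnj s * s / x"
      by (cases "x = 0") (simp_all add: uc cx s0 field_simps)
    also have "cnj s * s / x = (\<Sum>a\<in>A. \<Sum>b\<in>A. cnj (v a) * (M a c * M c b / x) * v b)"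
      unfolding cs[symmetric] unfolding s_def sum_product sum_divide_distrib
      by (intro sum.cong refl) (simp add: mult_ac)
    also have "(\<Sum>a\<in>A. \<Sum>b\<in>A. cnj (v a) * M a b * v b) - \<dots> = (\<Sum>a\<in>A. \<Sum>b\<in>A. cnj (v a) * M' a b * v b)"
      by (simp add: M'_def algebra_simps sum_subtractf)
    finally show ?thesis using pos[of u] by simp
  qed
  obtain w where w: "\<And>a b. a \<in> A \<Longrightarrow> b \<in> A \<Longrightarrow> M' a b = (\<Sum>m\<in>A. w m a * cnj (w m b))"
    using insert.IH[OF pos'] by blast
  \<comment> \<open>The new vector is the scaled column \<open>c\<close>; the old vectors are made
    to vanish at \<open>c\<close>, so they contribute nothing to that row and column.\<close>
  define w' where "w' m a = (if m = c then M a c / of_real (sqrt (Re x)) else if a = c then 0 else w m a)" for m a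
  have sq: "of_real (sqrt (Re x)) * of_real (sqrt (Re x)) = x"
    using xnn by (simp add: complex_nonneg_Reals_iff complex_eq_iff)
  have wc: "w' c a * cnj (w' c b) = M a c * M c b / x" if "a \<in> insert c A" "b \<in> insert c A" for a b
    using herm[of b c] that by (simp add: w'_def sq)
  have "M a b = (\<Sum>m\<in>insert c A. w' m a * cnj (w' m b))" if ab: "a \<in> insert c A" "b \<in> insert c A" for a b
  proof -
    have *: "(\<Sum>m\<in>A. w' m a * cnj (w' m b)) = (if a = c \<or> b = c then 0 else \<Sum>m\<in>A. w m a * cnj (w m b))"
      using insert.hyps by (auto simp: w'_def intro!: sum.neutral sum.cong)
    show ?thesis
    proof (cases "a = c \<or> b = c")
      case True
      have "M a b = M a c * M c b / x"
      proof (cases "x = 0")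
        case x0: True
        then show ?thesis using True row0[OF x0 ab(1)] row0[OF x0 ab(2)] herm[of b c] ab
          by auto
      next
        case False
        then show ?thesis using True by (auto simp: x_def)
      qed
      then show ?thesis using insert.hyps * True by (simp add: wc[OF ab])
    next
      case False
      then have "M' a b = (\<Sum>m\<in>A. w m a * cnj (w m b))" using w ab by auto
      moreover have "M a b = M a c * M c b / x + M' a b" by (simp add: M'_def)
      ultimately show ?thesis using insert.hyps * False by (simp add: wc[OF ab])
    qed
  qed
  then show ?case by blast
qed

section \<open>Inner products and positivity of operators on configurations\<close>

lemma finite_cfgs [simp]: "finite S \<Longrightarrow> finite (cfgs d S)"
  unfolding cfgs_def by (simp add: finite_PiE)

lemma cnj_hs_inner: "cnj (hs_inner d S A B) = hs_inner d S B A"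
  by (simp add: hs_inner_def mult.commute)

lemma hs_inner_cong:
  "op_eq d S A A' \<Longrightarrow> op_eq d S B B' \<Longrightarrow> hs_inner d S A B = hs_inner d S A' B'"
  by (simp add: hs_inner_def op_eq_def)

lemma op_eq_refl [simp]: "op_eq d S A A"
  by (simp add: op_eq_def)

text \<open>The quadratic form is a pairing with a rank-one operator, so closure properties of
  positivity follow from linearity of \<open>hs_inner\<close>.\<close>

lemma psd_iff_hs_inner:
  "psd d S M \<longleftrightarrow> (\<forall>v. hs_inner d S (\<lambda>a b. v a * cnj (v b)) M \<in> \<real>\<^sub>\<ge>\<^sub>0)"
  unfolding psd_def hs_inner_def Let_def complex_nonneg_Reals_iff
  by (auto simp: mult_ac)

lemma psd_cong: "op_eq d S A B \<Longrightarrow> psd d S A \<longleftrightarrow> psd d S B"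
  by (simp add: psd_iff_hs_inner hs_inner_cong[OF op_eq_refl, of d S A B])

lemma psd_gram:
  assumes "finite S" "psd d S M"
  shows "\<exists>w. \<forall>a\<in>cfgs d S. \<forall>b\<in>cfgs d S. M a b = (\<Sum>m\<in>cfgs d S. w m a * cnj (w m b))"
  by (rule nonneg_form_gram)
    (use assms in \<open>auto simp: psd_def Let_def complex_nonneg_Reals_iff\<close>)

lemma psd_hermitian:
  assumes "finite S" "psd d S M" "a \<in> cfgs d S" "b \<in> cfgs d S"
  shows "M b a = cnj (M a b)"
  by (rule nonneg_form_hermitian[of "cfgs d S"])
    (use assms in \<open>auto simp: psd_def Let_def complex_nonneg_Reals_iff\<close>)

lemma hs_inner_sum_left:
  "hs_inner d S (\<lambda>a b. \<Sum>i\<in>I. A i a b) B = (\<Sum>i\<in>I. hs_inner d S (A i) B)"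
  unfolding hs_inner_def cnj_sum sum_distrib_right
  by (subst (2) sum.swap, subst sum.swap) (rule refl)

lemma hs_inner_sum_right:
  "hs_inner d S A (\<lambda>a b. \<Sum>i\<in>I. B i a b) = (\<Sum>i\<in>I. hs_inner d S A (B i))"
  using arg_cong[OF hs_inner_sum_left[where I = I and A = B and B = A and d = d and S = S], of cnj] by (simp add: cnj_hs_inner)

lemma hs_inner_diff_left:
  "hs_inner d S (\<lambda>a b. A a b - B a b) C = hs_inner d S A C - hs_inner d S B C"
  by (simp add: hs_inner_def algebra_simps sum_subtractf)

lemma hs_inner_add_right:
  "hs_inner d S C (\<lambda>a b. A a b + B a b) = hs_inner d S C A + hs_inner d S C B"
  by (simp add: hs_inner_def algebra_simps sum.distrib)

lemma hs_inner_diff_right: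
  "hs_inner d S C (\<lambda>a b. A a b - B a b) = hs_inner d S C A - hs_inner d S C B"
  by (simp add: hs_inner_def algebra_simps sum_subtractf)

lemma hs_inner_scale_right:
  "hs_inner d S A (\<lambda>a b. c * B a b) = c * hs_inner d S A B"
  by (simp add: hs_inner_def sum_distrib_left mult_ac)

text \<open>The Gram vectors of \<open>A\<close> split the pairing into values of the quadratic form
  of \<open>B\<close>.\<close>

lemma hs_inner_psd:
  assumes "finite S" "psd d S A" "psd d S B"
  shows "hs_inner d S A B \<in> \<real>\<^sub>\<ge>\<^sub>0"
proof -
  obtain w where "\<forall>a\<in>cfgs d S. \<forall>b\<in>cfgs d S. A a b = (\<Sum>m\<in>cfgs d S. w m a * cnj (w m b))"
    using psd_gram[OF assms(1,2)] by blast
  then have "hs_inner d S A B = hs_inner d S (\<lambda>a b. \<Sum>m\<in>cfgs d S. w m a * cnj (w m b)) B"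
    by (intro hs_inner_cong) (auto simp: op_eq_def)
  also have "\<dots> \<in> \<real>\<^sub>\<ge>\<^sub>0"
    unfolding hs_inner_sum_left using assms(3) by (intro nonneg_Reals_sum) (simp add: psd_iff_hs_inner)
  finally show ?thesis .
qed

text \<open>The form becomes a sum of squared moduli. The index set \<open>I\<close> is arbitrary so
  that products of Gram representations fit.\<close>

lemma psd_gramI:
  assumes "\<And>a b. a \<in> cfgs d S \<Longrightarrow> b \<in> cfgs d S \<Longrightarrow> M a b = (\<Sum>m\<in>I. w m a * cnj (w m b))"
  shows "psd d S M"
proof -
  have "hs_inner d S (\<lambda>a b. v a * cnj (v b)) M \<in> \<real>\<^sub>\<ge>\<^sub>0" for v
  proof -
    have "hs_inner d S (\<lambda>a b. v a * cnj (v b)) M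
        = (\<Sum>m\<in>I. hs_inner d S (\<lambda>a b. v a * cnj (v b)) (\<lambda>a b. w m a * cnj (w m b)))"
      unfolding hs_inner_sum_right[symmetric] using assms by (intro hs_inner_cong) (auto simp: op_eq_def)
    also have "\<dots> = (\<Sum>m\<in>I. of_real ((cmod (\<Sum>a\<in>cfgs d S. cnj (v a) * w m a))\<^sup>2))"
      unfolding hs_inner_def complex_norm_square cnj_sum sum_product by (simp add: mult_ac)
    also have "\<dots> \<in> \<real>\<^sub>\<ge>\<^sub>0"
      by (intro nonneg_Reals_sum) (simp only: nonneg_Reals_of_real_iff zero_le_power2)
    finally show ?thesis .
  qed
  then show ?thesis by (simp add: psd_iff_hs_inner)
qed

lemma psd_rank_one: "psd d S (\<lambda>a b. v a * cnj (v b))"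
  by (rule psd_gramI[where I = "{()}" and w = "\<lambda>_. v"]) simp

lemma psd_zero: "psd d S (\<lambda>_ _. 0)"
  using psd_rank_one[of d S "\<lambda>_. 0"] by simp

lemma psd_add: "psd d S A \<Longrightarrow> psd d S B \<Longrightarrow> psd d S (\<lambda>a b. A a b + B a b)"
  unfolding psd_iff_hs_inner hs_inner_add_right by simp

lemma psd_scale: "c \<ge> 0 \<Longrightarrow> psd d S A \<Longrightarrow> psd d S (\<lambda>a b. of_real c * A a b)"
  unfolding psd_iff_hs_inner hs_inner_scale_right by simp

section \<open>Tensor products and partial traces\<close>

lemma restrict_join_left: "a \<in> cfgs d S \<Longrightarrow> S \<inter> T = {} \<Longrightarrow> restrict (join a c T) S = a"
  by (auto simp: join_def cfgs_def restrict_def PiE_def extensional_def fun_eq_iff)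

lemma restrict_join_right: "c \<in> cfgs d T \<Longrightarrow> restrict (join a c T) T = c"
  by (auto simp: join_def cfgs_def restrict_def PiE_def extensional_def fun_eq_iff)

lemma restrict_in_cfgs: "a \<in> cfgs d S' \<Longrightarrow> S \<subseteq> S' \<Longrightarrow> restrict a S \<in> cfgs d S"
  by (auto simp: cfgs_def PiE_def extensional_def)

lemma sum_cfgs_Un:
  assumes "S \<inter> T = {}"
  shows "(\<Sum>a\<in>cfgs d (S \<union> T). f a) = (\<Sum>x\<in>cfgs d S. \<Sum>y\<in>cfgs d T. f (join x y T))"
proof -
  have "(\<Sum>a\<in>cfgs d (S \<union> T). f a) = (\<Sum>(x,y)\<in>cfgs d S \<times> cfgs d T. f (join x y T))"
  proof (rule sum.reindex_bij_witness[where i = "\<lambda>(x,y). join x y T" and j = "\<lambda>a. (restrict a S, restrict a T)"], goal_cases)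
    case (1 a)
    then show ?case
      by (auto simp: join_def cfgs_def restrict_def PiE_def extensional_def fun_eq_iff)
  next
    case (2 a)
    then show ?case by (auto intro: restrict_in_cfgs)
  next
    case (3 b)
    then show ?case using assms by (auto simp: restrict_join_left restrict_join_right)
  next
    case (4 b)
    then show ?case
      by (fastforce simp: join_def cfgs_def PiE_def extensional_def)
  next
    case (5 a)
    then have "join (restrict a S) (restrict a T) T = a"
      by (auto simp: join_def cfgs_def restrict_def PiE_def extensional_def fun_eq_iff)
    then show ?case by simp
  qed
  then show ?thesis by (simp add: sum.cartesian_product)
qed

lemma tensor_commute: "tensor S T A B = tensor T S B A"
  by (simp add: tensor_def fun_eq_iff mult.commute)

text \<open>Tensoring with the identity is adjoint to the partial trace. This adjunction carries
  constraints between strategies and co-strategies.\<close>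

lemma hs_inner_tensor_idop_left:
  assumes "S \<inter> T = {}" "finite T"
  shows "hs_inner d (S \<union> T) (tensor S T A idop) X = hs_inner d S A (ptrace d T X)"
proof -
  have "hs_inner d (S \<union> T) (tensor S T A idop) X
     = (\<Sum>x\<in>cfgs d S. \<Sum>y\<in>cfgs d T. \<Sum>x'\<in>cfgs d S. \<Sum>y'\<in>cfgs d T.
          (if y = y' then cnj (A x x') * X (join x y T) (join x' y' T) else 0))"
    unfolding hs_inner_def sum_cfgs_Un[OF assms(1)] tensor_def
    by (intro sum.cong refl) (auto simp: restrict_join_left restrict_join_right assms idop_def)
  also have "\<dots> = (\<Sum>x\<in>cfgs d S. \<Sum>y\<in>cfgs d T. \<Sum>x'\<in>cfgs d S. cnj (A x x') * X (join x y T) (join x' y T))"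
    using assms(2) by (simp add: sum.delta)
  also have "\<dots> = hs_inner d S A (ptrace d T X)"
    unfolding hs_inner_def ptrace_def sum_distrib_left by (subst (2) sum.swap) (rule refl)
  finally show ?thesis .
qed

lemma hs_inner_tensor_idop_right:
  assumes "S \<inter> T = {}" "finite T"
  shows "hs_inner d (S \<union> T) X (tensor S T A idop) = hs_inner d S (ptrace d T X) A"
  using arg_cong[OF hs_inner_tensor_idop_left[OF assms, of d A X], of cnj] by (simp add: cnj_hs_inner)

lemma cnj_idop [simp]: "cnj (idop a b) = idop a b"
  by (simp add: idop_def)

lemma sum_idop_mult_idop:
  assumes "finite C" "a \<in> C"
  shows "(\<Sum>c\<in>C. idop a c * idop b c) = idop a b"
proof -
  have "(\<Sum>c\<in>C. idop a c * idop b c) = (\<Sum>c\<in>C. if c = a then idop a b else 0)"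
    by (intro sum.cong refl) (auto simp: idop_def)
  then show ?thesis using assms by (simp add: sum.delta)
qed

lemma psd_tensor_idop:
  assumes "S \<inter> T = {}" "finite S" "finite T" "psd d S A"
  shows "psd d (S \<union> T) (tensor S T A idop)"
proof -
  obtain w where w: "\<forall>a\<in>cfgs d S. \<forall>b\<in>cfgs d S. A a b = (\<Sum>m\<in>cfgs d S. w m a * cnj (w m b))"
    using psd_gram[OF assms(2,4)] by blast
  show ?thesis
  proof (rule psd_gramI)
    fix a b assume ab: "a \<in> cfgs d (S \<union> T)" "b \<in> cfgs d (S \<union> T)"
    have r: "restrict a S \<in> cfgs d S" "restrict b S \<in> cfgs d S" "restrict a T \<in> cfgs d T" "restrict b T \<in> cfgs d T"
      using ab by (auto intro: restrict_in_cfgs)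
    have "tensor S T A idop a b
       = (\<Sum>m\<in>cfgs d S. w m (restrict a S) * cnj (w m (restrict b S))) * (\<Sum>c\<in>cfgs d T. idop (restrict a T) c * idop (restrict b T) c)"
      using w r assms(3) by (simp add: tensor_def sum_idop_mult_idop)
    also have "\<dots> = (\<Sum>(m,c)\<in>cfgs d S \<times> cfgs d T.
       (w m (restrict a S) * idop (restrict a T) c) * cnj (w m (restrict b S) * idop (restrict b T) c))"
      unfolding sum_product sum.cartesian_product by (intro sum.cong refl) (auto simp: mult_ac)
    finally show "tensor S T A idop a b = (\<Sum>p\<in>cfgs d S \<times> cfgs d T.
       (case p of (m,c) \<Rightarrow> \<lambda>a. w m (restrict a S) * idop (restrict a T) c) a
        * cnj ((case p of (m,c) \<Rightarrow> \<lambda>a. w m (restrict a S) * idop (restrict a T) c) b))"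
      by (simp add: case_prod_beta)
  qed
qed

text \<open>By adjointness, the form of the partial trace at \<open>v\<close> is the pairing of
  \<open>M\<close> with a rank-one operator tensored with the identity.\<close>

lemma psd_ptrace:
  assumes "S \<inter> T = {}" "finite S" "finite T" "psd d (S \<union> T) M"
  shows "psd d S (ptrace d T M)"
  unfolding psd_iff_hs_inner
proof
  fix v
  show "hs_inner d S (\<lambda>a b. v a * cnj (v b)) (ptrace d T M) \<in> \<real>\<^sub>\<ge>\<^sub>0"
    unfolding hs_inner_tensor_idop_left[OF assms(1,3), symmetric]
    by (rule hs_inner_psd) (use assms psd_tensor_idop[OF assms(1-3) psd_rank_one] in auto)
qed

lemma ptrace_tensor_idop:
  assumes "S \<inter> T = {}" "finite T" "a \<in> cfgs d S" "b \<in> cfgs d S"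
  shows "ptrace d T (tensor S T A idop) a b = of_nat (card (cfgs d T)) * A a b"
  using assms by (simp add: ptrace_def tensor_def restrict_join_left restrict_join_right idop_def)

text \<open>Tracing the identity factor out returns \<open>A\<close> times the dimension of
  \<open>T\<close>, which is nonzero because all registers have positive dimension.\<close>

lemma psd_tensor_idopD:
  assumes "S \<inter> T = {}" "finite S" "finite T" "\<And>l. d l > 0" "psd d (S \<union> T) (tensor S T A idop)"
  shows "psd d S A"
proof -
  have ne: "cfgs d T \<noteq> {}" using assms(4) by (auto simp: cfgs_def PiE_eq_empty_iff lessThan_empty_iff)
  then have c: "card (cfgs d T) > 0" using assms(3) by (simp add: card_gt_0_iff)
  have "psd d S (\<lambda>a b. of_real (1 / real (card (cfgs d T))) * ptrace d T (tensor S T A idop) a b)"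
    by (intro psd_scale psd_ptrace assms) simp
  moreover have "op_eq d S (\<lambda>a b. of_real (1 / real (card (cfgs d T))) * ptrace d T (tensor S T A idop) a b) A"
    unfolding op_eq_def using c by (auto simp: ptrace_tensor_idop[OF assms(1,3)])
  ultimately show ?thesis using psd_cong by blast
qed

lemma hs_inner_idop:
  assumes "finite S"
  shows "hs_inner d S A idop = cnj (tr d S A)"
proof -
  have "(\<Sum>b\<in>cfgs d S. cnj (A a b) * idop a b) = (\<Sum>b\<in>cfgs d S. if a = b then cnj (A a b) else 0)" for a
    by (intro sum.cong refl) (auto simp: idop_def)
  then show ?thesis using assms by (simp add: hs_inner_def tr_def sum.delta')
qed

lemma psd_idop: "finite S \<Longrightarrow> psd d S idop"
  by (rule psd_gramI[where I = "cfgs d S" and w = "\<lambda>c a. idop a c"]) (simp add: sum_idop_mult_idop)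

lemma tr_psd:
  assumes "finite S" "psd d S A"
  shows "tr d S A \<in> \<real>\<^sub>\<ge>\<^sub>0"
  using hs_inner_psd[OF assms psd_idop[OF assms(1)]]
  by (simp add: hs_inner_idop[OF assms(1)] complex_nonneg_Reals_iff)

section \<open>Tensor powers\<close>

text \<open>With the identity as selector, \<open>prod_op\<close> is a tensor product whose factors
  vary from copy to copy.\<close>

abbreviation tens :: "nat \<Rightarrow> reg set \<Rightarrow> (nat \<Rightarrow> reg op) \<Rightarrow> (nat \<times> reg) op" where
  "tens n S F \<equiv> prod_op n S F (\<lambda>k. k)"

lemma prod_op_eq_tens: "prod_op n S P i = tens n S (\<lambda>k. P (i k))"
  by (simp add: prod_op_def fun_eq_iff)

lemma copy_in_cfgs:
  "a \<in> cfgs (nd d) ({..<n} \<times> S) \<Longrightarrow> k < n \<Longrightarrow> restrict (\<lambda>l. a (k, l)) S \<in> cfgs d S"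
  by (auto simp: cfgs_def nd_def PiE_iff)

text \<open>A joint configuration is the same as a tuple of configurations, one per copy; sums of
  products over copies then factorise.\<close>

lemma sum_cfgs_copies:
  "(\<Sum>a\<in>cfgs (nd d) ({..<n} \<times> S). F (\<lambda>k\<in>{..<n}. restrict (\<lambda>l. a (k, l)) S))
     = (\<Sum>g\<in>PiE {..<n} (\<lambda>_. cfgs d S). F g)"
proof (rule sum.reindex_bij_witness[where j = "\<lambda>a. \<lambda>k\<in>{..<n}. restrict (\<lambda>l. a (k, l)) S"
      and i = "\<lambda>g. restrict (\<lambda>(k, l). g k l) ({..<n} \<times> S)"], goal_cases)
  case (1 a)
  then show ?case by (auto simp: cfgs_def fun_eq_iff PiE_def extensional_def restrict_def)
next
  case (2 a)
  then show ?case by (auto simp: PiE_iff copy_in_cfgs)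
next
  case (3 g)
  then have "g k \<in> extensional S" if "k < n" for k using that by (auto simp: cfgs_def PiE_def)
  then show ?case using 3 by (auto simp: fun_eq_iff PiE_def extensional_def restrict_def)
next
  case (4 g)
  then show ?case by (auto simp: cfgs_def PiE_iff nd_def)
next
  case (5 a)
  then show ?case by simp
qed

lemma sum_cfgs_copies_prod:
  fixes f :: "nat \<Rightarrow> (reg \<Rightarrow> nat) \<Rightarrow> complex"
  assumes "finite S"
  shows "(\<Sum>a\<in>cfgs (nd d) ({..<n} \<times> S). \<Prod>k<n. f k (restrict (\<lambda>l. a (k, l)) S))
     = (\<Prod>k<n. \<Sum>x\<in>cfgs d S. f k x)"
proof -
  have "(\<Prod>k<n. \<Sum>x\<in>cfgs d S. f k x) = (\<Sum>g\<in>PiE {..<n} (\<lambda>_. cfgs d S). \<Prod>k<n. f k (g k))"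
    by (rule prod_sum_PiE) (use assms in auto)
  also have "\<dots> = (\<Sum>a\<in>cfgs (nd d) ({..<n} \<times> S). \<Prod>k<n. f k ((\<lambda>k\<in>{..<n}. restrict (\<lambda>l. a (k, l)) S) k))"
    by (rule sum_cfgs_copies[symmetric])
  finally show ?thesis by simp
qed

lemma tens_cong:
  assumes "\<And>k. k < n \<Longrightarrow> op_eq d S (A k) (B k)"
  shows "op_eq (nd d) ({..<n} \<times> S) (tens n S A) (tens n S B)"
  using assms copy_in_cfgs[of _ d n S] by (simp add: op_eq_def prod_op_def)

lemma tens_tensor:
  "tens n (S \<union> T) (\<lambda>k. tensor S T (A k) (B k)) = tensor ({..<n} \<times> S) ({..<n} \<times> T) (tens n S A) (tens n T B)"
proof (intro ext)
  fix a b :: "nat \<times> reg \<Rightarrow> nat"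
  have 1: "restrict (restrict (\<lambda>l. a (k, l)) (S \<union> T)) S = restrict (\<lambda>l. a (k, l)) S"
          "restrict (restrict (\<lambda>l. a (k, l)) (S \<union> T)) T = restrict (\<lambda>l. a (k, l)) T" for k and a :: "nat \<times> reg \<Rightarrow> nat"
    by (auto simp: restrict_def fun_eq_iff)
  have 2: "restrict (\<lambda>l. restrict a ({..<n} \<times> S) (k, l)) S = restrict (\<lambda>l. a (k, l)) S" if "k < n" for k S and a :: "nat \<times> reg \<Rightarrow> nat"
    using that by (auto simp: restrict_def fun_eq_iff)
  show "tens n (S \<union> T) (\<lambda>k. tensor S T (A k) (B k)) a b = tensor ({..<n} \<times> S) ({..<n} \<times> T) (tens n S A) (tens n T B) a b"
    unfolding tensor_def prod_op_def 1 prod.distrib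
    by (intro arg_cong2[where f = "(*)"] prod.cong refl) (simp_all only: 2 lessThan_iff)
qed

lemma tens_idop: "op_eq (nd d) ({..<n} \<times> S) (tens n S (\<lambda>_. idop)) idop"
  unfolding op_eq_def
proof (intro ballI)
  fix a b assume ab: "a \<in> cfgs (nd d) ({..<n} \<times> S)" "b \<in> cfgs (nd d) ({..<n} \<times> S)"
  show "tens n S (\<lambda>_. idop) a b = idop a b"
  proof (cases "a = b")
    case True
    then show ?thesis by (simp add: prod_op_def idop_def)
  next
    case False
    then obtain p where p: "a p \<noteq> b p" by (meson ext)
    \<comment> \<open>Configurations are \<open>undefined\<close> off their registers, so they can
      differ only at a genuine register of some copy.\<close>
    obtain k l where kl: "p = (k, l)" "k < n" "l \<in> S"
    proof (cases "p \<in> {..<n} \<times> S")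
      case False
      then have "a p = undefined" "b p = undefined"
        using ab unfolding cfgs_def by (blast intro: PiE_arb)+
      then show ?thesis using p by simp
    qed (use that in auto)
    have "restrict (\<lambda>l. a (k, l)) S \<noteq> restrict (\<lambda>l. b (k, l)) S"
      using p kl by (metis restrict_apply')
    then show ?thesis using False kl(2) by (auto simp: prod_op_def idop_def prod_zero_iff)
  qed
qed

lemma tensor_cong:
  assumes "op_eq d S A A'" "op_eq d T B B'"
  shows "op_eq d (S \<union> T) (tensor S T A B) (tensor S T A' B')"
  using assms by (auto simp: op_eq_def tensor_def restrict_in_cfgs)

lemma op_eq_trans: "op_eq d S A B \<Longrightarrow> op_eq d S B C \<Longrightarrow> op_eq d S A C"
  by (simp add: op_eq_def)

lemma op_eq_sym: "op_eq d S A B \<Longrightarrow> op_eq d S B A"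
  by (simp add: op_eq_def)

lemma copies_Un: "{..<n} \<times> (S \<union> T) = {..<n} \<times> S \<union> {..<n} \<times> T"
  by auto

lemma tens_tensor_idop:
  "op_eq (nd d) ({..<n} \<times> (S \<union> T)) (tens n (S \<union> T) (\<lambda>k. tensor S T (A k) idop))
     (tensor ({..<n} \<times> S) ({..<n} \<times> T) (tens n S A) idop)"
  unfolding tens_tensor copies_Un by (intro tensor_cong op_eq_refl tens_idop)

lemma ptrace_tens:
  assumes "S \<inter> T = {}" "finite T"
  shows "ptrace (nd d) ({..<n} \<times> T) (tens n (S \<union> T) A) = tens n S (\<lambda>k. ptrace d T (A k))"
proof (intro ext)
  fix a b :: "nat \<times> reg \<Rightarrow> nat"
  have j: "restrict (\<lambda>l. join a c ({..<n} \<times> T) (k, l)) (S \<union> T)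
      = join (restrict (\<lambda>l. a (k, l)) S) (restrict (\<lambda>l. c (k, l)) T) T" if "k < n" for k a c
    using that assms by (auto simp: fun_eq_iff join_def restrict_def)
  show "ptrace (nd d) ({..<n} \<times> T) (tens n (S \<union> T) A) a b = tens n S (\<lambda>k. ptrace d T (A k)) a b"
    unfolding ptrace_def prod_op_def
    by (subst sum_cfgs_copies_prod[OF assms(2), symmetric]) (simp add: j)
qed

lemma hs_inner_tens:
  assumes "finite S"
  shows "hs_inner (nd d) ({..<n} \<times> S) (tens n S A) (tens n S B) = (\<Prod>k<n. hs_inner d S (A k) (B k))"
proof -
  let ?s = "\<lambda>a k. restrict (\<lambda>l. a (k, l)) S"
  let ?f = "\<lambda>k x y. cnj (A k x y) * B k x y"
  have "hs_inner (nd d) ({..<n} \<times> S) (tens n S A) (tens n S B)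
     = (\<Sum>a\<in>cfgs (nd d) ({..<n} \<times> S). \<Sum>b\<in>cfgs (nd d) ({..<n} \<times> S). \<Prod>k<n. ?f k (?s a k) (?s b k))"
    by (simp add: hs_inner_def prod_op_def prod.distrib)
  also have "\<dots> = (\<Sum>a\<in>cfgs (nd d) ({..<n} \<times> S). \<Prod>k<n. \<Sum>y\<in>cfgs d S. ?f k (?s a k) y)"
    by (intro sum.cong refl sum_cfgs_copies_prod[OF assms])
  also have "\<dots> = (\<Prod>k<n. \<Sum>x\<in>cfgs d S. \<Sum>y\<in>cfgs d S. ?f k x y)"
    by (rule sum_cfgs_copies_prod[OF assms])
  finally show ?thesis by (simp add: hs_inner_def)
qed

lemma tens_sum:
  assumes "\<And>k. k < n \<Longrightarrow> finite (Z k)"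
  shows "tens n S (\<lambda>k a b. \<Sum>x\<in>Z k. P k x a b) = (\<lambda>a b. \<Sum>i\<in>PiE {..<n} Z. tens n S (\<lambda>k. P k (i k)) a b)"
  unfolding prod_op_def by (intro ext, subst prod_sum_PiE) (use assms in auto)

lemma psd_tens:
  assumes "finite S" "\<And>k. k < n \<Longrightarrow> psd d S (A k)"
  shows "psd (nd d) ({..<n} \<times> S) (tens n S A)"
proof -
  have "\<forall>k. \<exists>w. k < n \<longrightarrow> (\<forall>a\<in>cfgs d S. \<forall>b\<in>cfgs d S. A k a b = (\<Sum>m\<in>cfgs d S. w m a * cnj (w m b)))"
    using psd_gram[OF assms(1)] assms(2) by blast
  then obtain w where w: "\<And>k a b. k < n \<Longrightarrow> a \<in> cfgs d S \<Longrightarrow> b \<in> cfgs d S \<Longrightarrow>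
      A k a b = (\<Sum>m\<in>cfgs d S. w k m a * cnj (w k m b))" by metis
  show ?thesis
  proof (rule psd_gramI)
    fix a b assume ab: "a \<in> cfgs (nd d) ({..<n} \<times> S)" "b \<in> cfgs (nd d) ({..<n} \<times> S)"
    have "tens n S A a b = (\<Prod>k<n. \<Sum>m\<in>cfgs d S. w k m (restrict (\<lambda>l. a (k, l)) S) * cnj (w k m (restrict (\<lambda>l. b (k, l)) S)))"
      unfolding prod_op_def by (intro prod.cong refl w copy_in_cfgs[OF ab(1)] copy_in_cfgs[OF ab(2)]) auto
    also have "\<dots> = (\<Sum>i\<in>PiE {..<n} (\<lambda>_. cfgs d S). \<Prod>k<n. w k (i k) (restrict (\<lambda>l. a (k, l)) S) * cnj (w k (i k) (restrict (\<lambda>l. b (k, l)) S)))"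
      by (rule prod_sum_PiE) (use assms in auto)
    finally show "tens n S A a b = (\<Sum>i\<in>PiE {..<n} (\<lambda>_. cfgs d S).
       (\<Prod>k<n. w k (i k) (restrict (\<lambda>l. a (k, l)) S)) * cnj (\<Prod>k<n. w k (i k) (restrict (\<lambda>l. b (k, l)) S)))"
      by (simp add: prod.distrib)
  qed
qed

text \<open>Expanding \<open>B = A + (B - A)\<close> in every factor, all terms but the first are dropped.\<close>

lemma hs_inner_tens_mono:
  assumes "finite S" "psd (nd d) ({..<n} \<times> S) X"
    and A: "\<And>k. k < n \<Longrightarrow> psd d S (A k)"
    and BA: "\<And>k. k < n \<Longrightarrow> psd d S (\<lambda>a b. B k a b - A k a b)"
  shows "Re (hs_inner (nd d) ({..<n} \<times> S) (tens n S A) X) \<le> Re (hs_inner (nd d) ({..<n} \<times> S) (tens n S B) X)"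
proof -
  define P where "P k x = (if x = (0::nat) then A k else (\<lambda>a b. B k a b - A k a b))" for k x
  let ?I = "PiE {..<n} (\<lambda>_. {0, 1::nat})"
  have nn: "Re (hs_inner (nd d) ({..<n} \<times> S) (tens n S (\<lambda>k. P k (i k))) X) \<ge> 0" for i
  proof -
    have "psd (nd d) ({..<n} \<times> S) (tens n S (\<lambda>k. P k (i k)))"
      by (rule psd_tens) (use assms in \<open>auto simp: P_def\<close>)
    then have "hs_inner (nd d) ({..<n} \<times> S) (tens n S (\<lambda>k. P k (i k))) X \<in> \<real>\<^sub>\<ge>\<^sub>0"
      using assms(1,2) by (intro hs_inner_psd) auto
    then show ?thesis by (simp add: complex_nonneg_Reals_iff)
  qed
  have "tens n S B = tens n S (\<lambda>k a b. \<Sum>x\<in>{0,1}. P k x a b)"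
    by (simp add: P_def)
  also have "\<dots> = (\<lambda>a b. \<Sum>i\<in>?I. tens n S (\<lambda>k. P k (i k)) a b)"
    by (rule tens_sum) simp
  finally have "hs_inner (nd d) ({..<n} \<times> S) (tens n S B) X
      = (\<Sum>i\<in>?I. hs_inner (nd d) ({..<n} \<times> S) (tens n S (\<lambda>k. P k (i k))) X)"
    by (simp only: hs_inner_sum_left)
  then have B: "Re (hs_inner (nd d) ({..<n} \<times> S) (tens n S B) X)
      = (\<Sum>i\<in>?I. Re (hs_inner (nd d) ({..<n} \<times> S) (tens n S (\<lambda>k. P k (i k))) X))"
    by simp
  let ?z = "\<lambda>k\<in>{..<n}. 0::nat"
  have "tens n S A = tens n S (\<lambda>k. P k (?z k))"
    by (simp add: prod_op_def P_def fun_eq_iff)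
  then have "Re (hs_inner (nd d) ({..<n} \<times> S) (tens n S A) X)
     = Re (hs_inner (nd d) ({..<n} \<times> S) (tens n S (\<lambda>k. P k (?z k))) X)" by simp
  also have "\<dots> \<le> (\<Sum>i\<in>?I. Re (hs_inner (nd d) ({..<n} \<times> S) (tens n S (\<lambda>k. P k (i k))) X))"
    by (rule member_le_sum[of ?z]) (auto simp: nn intro: finite_PiE)
  finally show ?thesis using B by simp
qed

section \<open>Strategies, co-strategies and weak duality\<close>

abbreviation after :: "nat \<Rightarrow> reg set" where "after j \<equiv> Ys j \<union> Xs j"
abbreviation before :: "nat \<Rightarrow> reg set" where "before j \<equiv> Ys (j - 1) \<union> Xs j"

lemma finite_Xs [simp]: "finite (Xs j)" and finite_Ys [simp]: "finite (Ys j)"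
  by (simp_all add: Xs_def Ys_def)

lemma Xs_insert: "j \<ge> 1 \<Longrightarrow> Xs j = Xs (j - 1) \<union> {RX j}"
  by (cases j) (auto simp: Xs_def atLeastAtMostSuc_conv)

lemma Ys_insert: "j \<ge> 1 \<Longrightarrow> Ys j = Ys (j - 1) \<union> {RY j}"
  by (cases j) (auto simp: Ys_def atLeastAtMostSuc_conv)

lemma after_eq: "j \<ge> 1 \<Longrightarrow> after j = before j \<union> {RY j}"
  using Ys_insert[of j] by auto

lemma before_eq: "j \<ge> 1 \<Longrightarrow> before j = after (j - 1) \<union> {RX j}"
  using Xs_insert[of j] by auto

lemma before_disjoint: "j \<ge> 1 \<Longrightarrow> before j \<inter> {RY j} = {}"
  by (auto simp: Xs_def Ys_def)

lemma after_disjoint: "j \<ge> 1 \<Longrightarrow> after (j - 1) \<inter> {RX j} = {}"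
  by (auto simp: Xs_def Ys_def)

lemma Ys_0 [simp]: "Ys 0 = {}" and Xs_0 [simp]: "Xs 0 = {}"
  by (simp_all add: Xs_def Ys_def)

lemma copies_after: "nYs n j \<union> nXs n j = {..<n} \<times> after j"
  by (auto simp: nYs_def nXs_def)

lemma copies_before: "nYs n (j - 1) \<union> nXs n j = {..<n} \<times> before j"
  by (auto simp: nYs_def nXs_def)

text \<open>The identity on Y_j tensored with R_j from the verifier condition, with the factors in
  the other order.\<close>

abbreviation ext_id :: "nat \<Rightarrow> reg op \<Rightarrow> reg op" where
  "ext_id j R \<equiv> tensor (before j) {RY j} R idop"

lemma hs_inner_ext_id:
  assumes "j \<ge> 1"
  shows "hs_inner d (after j) (ext_id j R) X = hs_inner d (before j) R (ptrace d {RY j} X)"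
  unfolding after_eq[OF assms] by (rule hs_inner_tensor_idop_left[OF before_disjoint[OF assms]]) simp

lemma hs_inner_tens_ext_id:
  assumes "j \<ge> 1"
  shows "hs_inner (nd d) ({..<n} \<times> after j) (tens n (after j) (\<lambda>k. ext_id j (R k))) X
     = hs_inner (nd d) ({..<n} \<times> before j) (tens n (before j) R) (ptrace (nd d) ({..<n} \<times> {RY j}) X)"
proof -
  have "hs_inner (nd d) ({..<n} \<times> after j) (tens n (after j) (\<lambda>k. ext_id j (R k))) X
    = hs_inner (nd d) ({..<n} \<times> after j) (tensor ({..<n} \<times> before j) ({..<n} \<times> {RY j}) (tens n (before j) R) idop) X"
    unfolding after_eq[OF assms] by (intro hs_inner_cong tens_tensor_idop op_eq_refl)
  also have "\<dots> = hs_inner (nd d) ({..<n} \<times> before j) (tens n (before j) R) (ptrace (nd d) ({..<n} \<times> {RY j}) X)"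
    unfolding after_eq[OF assms] copies_Un
    by (rule hs_inner_tensor_idop_left) (use before_disjoint[OF assms] in auto)
  finally show ?thesis .
qed

text \<open>A strategy constraint is paired with a product operator, and the adjunction moves the
  identity across. The operators \<open>R\<close> are arbitrary and may differ between copies, so
  the same recursion yields both the inequality of weak duality and the normalisation of
  probabilities.\<close>

lemma strategy_unroll:
  assumes "strategy n r d X" "r \<ge> 1"
  obtains Xj where "Xj r = X"
    and "\<And>j. j \<in> {1..r} \<Longrightarrow> psd (nd d) ({..<n} \<times> after j) (Xj j)"
    and "\<And>R. hs_inner (nd d) ({..<n} \<times> after 1) (tens n (after 1) (\<lambda>k. ext_id 1 (R k))) (Xj 1)
          = (\<Prod>k<n. cnj (tr d (Xs 1) (R k)))"
    and "\<And>j R. j \<in> {1..<r} \<Longrightarrow>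
        hs_inner (nd d) ({..<n} \<times> after (Suc j)) (tens n (after (Suc j)) (\<lambda>k. ext_id (Suc j) (R k))) (Xj (Suc j))
          = hs_inner (nd d) ({..<n} \<times> after j) (tens n (after j) (\<lambda>k. ptrace d {RX (Suc j)} (R k))) (Xj j)"
proof -
  from assms(1) obtain Xj where Xj:
      "\<And>j. j \<in> {1..r} \<Longrightarrow> psd (nd d) ({..<n} \<times> after j) (Xj j)" "Xj r = X"
      "op_eq (nd d) (nXs n 1) (ptrace (nd d) (nYs n 1) (Xj 1)) idop"
      "\<And>j. j \<in> {2..r} \<Longrightarrow> op_eq (nd d) ({..<n} \<times> before j)
             (ptrace (nd d) ({..<n} \<times> {RY j}) (Xj j))
             (tensor ({..<n} \<times> after (j - 1)) ({..<n} \<times> {RX j}) (Xj (j - 1)) idop)"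
    unfolding strategy_def copies_after copies_before by blast
  have Y1: "Ys 1 = {RY 1}" using Ys_insert[of 1] by simp
  have "hs_inner (nd d) ({..<n} \<times> after 1) (tens n (after 1) (\<lambda>k. ext_id 1 (R k))) (Xj 1)
          = (\<Prod>k<n. cnj (tr d (Xs 1) (R k)))" for R
  proof -
    have "hs_inner (nd d) ({..<n} \<times> before 1) (tens n (before 1) R) (ptrace (nd d) ({..<n} \<times> {RY 1}) (Xj 1))
       = hs_inner (nd d) ({..<n} \<times> Xs 1) (tens n (Xs 1) R) (tens n (Xs 1) (\<lambda>_. idop))"
      using op_eq_trans[OF Xj(3)[unfolded nXs_def nYs_def Y1] op_eq_sym[OF tens_idop]]
      by (simp add: hs_inner_cong[OF op_eq_refl])
    also have "\<dots> = (\<Prod>k<n. hs_inner d (Xs 1) (R k) idop)"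
      by (rule hs_inner_tens) simp
    also have "\<dots> = (\<Prod>k<n. cnj (tr d (Xs 1) (R k)))"
      by (simp add: hs_inner_idop)
    finally show ?thesis using hs_inner_tens_ext_id[of 1] by simp
  qed
  moreover have "hs_inner (nd d) ({..<n} \<times> after (Suc j)) (tens n (after (Suc j)) (\<lambda>k. ext_id (Suc j) (R k))) (Xj (Suc j))
          = hs_inner (nd d) ({..<n} \<times> after j) (tens n (after j) (\<lambda>k. ptrace d {RX (Suc j)} (R k))) (Xj j)"
    if j: "j \<in> {1..<r}" for j R
  proof -
    have S: "Suc j \<ge> 1" "Suc j \<in> {2..r}" using j by auto
    have be: "before (Suc j) = after j \<union> {RX (Suc j)}" and ad: "after j \<inter> {RX (Suc j)} = {}"
      using before_eq[OF S(1)] after_disjoint[OF S(1)] by simp_all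
    have "hs_inner (nd d) ({..<n} \<times> before (Suc j)) (tens n (before (Suc j)) R) (ptrace (nd d) ({..<n} \<times> {RY (Suc j)}) (Xj (Suc j)))
      = hs_inner (nd d) ({..<n} \<times> before (Suc j)) (tens n (before (Suc j)) R) (tensor ({..<n} \<times> after j) ({..<n} \<times> {RX (Suc j)}) (Xj j) idop)"
      using Xj(4)[OF S(2)] by (intro hs_inner_cong) simp_all
    also have "\<dots> = hs_inner (nd d) ({..<n} \<times> after j) (ptrace (nd d) ({..<n} \<times> {RX (Suc j)}) (tens n (before (Suc j)) R)) (Xj j)"
      unfolding be copies_Un[of n "after j"] by (rule hs_inner_tensor_idop_right) (use ad in auto)
    also have "ptrace (nd d) ({..<n} \<times> {RX (Suc j)}) (tens n (before (Suc j)) R) = tens n (after j) (\<lambda>k. ptrace d {RX (Suc j)} (R k))"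
      unfolding be by (rule ptrace_tens) (use ad in auto)
    finally show ?thesis by (simp only: hs_inner_tens_ext_id[OF S(1)])
  qed
  ultimately show ?thesis using Xj(1,2) that by blast
qed

text \<open>A co-strategy in the sense of the verifier condition, with equalities relaxed to the
  Loewner order; \<open>M\<close> is the operator it dominates.\<close>

definition dual_chain :: "nat \<Rightarrow> (reg \<Rightarrow> nat) \<Rightarrow> reg op \<Rightarrow> (nat \<Rightarrow> reg op) \<Rightarrow> bool" where
  "dual_chain r d M R \<longleftrightarrow>
     psd d (after r) (\<lambda>a b. ext_id r (R r) a b - M a b) \<and>
     (\<forall>j\<in>{1..<r}. psd d (after j) (\<lambda>a b. ext_id j (R j) a b - ptrace d {RX (Suc j)} (R (Suc j)) a b))"

text \<open>Positivity propagates from the last round to the first: \<open>ext_id j (R j)\<close>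
  dominates a positive operator, and the identity factor can be removed.\<close>

lemma dual_chain_psd:
  assumes "dual_chain r d M R" "psd d (after r) M" "\<And>l. d l > 0" "j \<in> {1..r}"
  shows "psd d (before j) (R j)"
proof -
  have ext: "psd d (before j) (R j)" if "psd d (after j) A" "psd d (after j) (\<lambda>a b. ext_id j (R j) a b - A a b)" "j \<ge> 1" for j A
  proof -
    have "psd d (after j) (\<lambda>a b. A a b + (ext_id j (R j) a b - A a b))"
      by (rule psd_add) (use that in auto)
    then have "psd d (before j \<union> {RY j}) (ext_id j (R j))"
      using after_eq[OF that(3)] by simp
    then show ?thesis
      by (rule psd_tensor_idopD[OF before_disjoint[OF that(3)]  _ _ assms(3), rotated 2]) auto
  qed
  have "j \<le> r" "j \<ge> 1" using assms(4) by auto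
  then show ?thesis
  proof (induction j rule: inc_induct)
    case base
    then show ?case using ext[OF assms(2)] assms(1) by (auto simp: dual_chain_def)
  next
    case (step i)
    have be: "before (Suc i) = after i \<union> {RX (Suc i)}" and ad: "after i \<inter> {RX (Suc i)} = {}"
      using before_eq[of "Suc i"] after_disjoint[of "Suc i"] by simp_all
    have "psd d (after i) (ptrace d {RX (Suc i)} (R (Suc i)))"
      using psd_ptrace[OF ad] step.IH be by simp
    then show ?case using ext[of i] step assms(1) by (auto simp: dual_chain_def)
  qed
qed

text \<open>Unrolling a round turns \<open>?V (Suc j)\<close> into a pairing with partial traces,
  which \<open>ext_id j\<close> dominates in every copy; so \<open>?V\<close> does not increase with
  the round. Each copy may carry its own operator and chain, as the union bound requires.\<close>

lemma weak_duality:
  assumes st: "strategy n r d X" and r: "r \<ge> 1" and d: "\<And>l. d l > 0"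
    and M: "\<And>k. k < n \<Longrightarrow> psd d (after r) (M k)"
    and R: "\<And>k. k < n \<Longrightarrow> dual_chain r d (M k) (R k)"
  shows "Re (hs_inner (nd d) ({..<n} \<times> after r) (tens n (after r) M) X) \<le> (\<Prod>k<n. Re (tr d (Xs 1) (R k 1)))"
proof -
  obtain Xj where Xj: "Xj r = X" "\<And>j. j \<in> {1..r} \<Longrightarrow> psd (nd d) ({..<n} \<times> after j) (Xj j)"
    and one: "\<And>R. hs_inner (nd d) ({..<n} \<times> after 1) (tens n (after 1) (\<lambda>k. ext_id 1 (R k))) (Xj 1)
          = (\<Prod>k<n. cnj (tr d (Xs 1) (R k)))"
    and unroll: "\<And>j R. j \<in> {1..<r} \<Longrightarrow>
        hs_inner (nd d) ({..<n} \<times> after (Suc j)) (tens n (after (Suc j)) (\<lambda>k. ext_id (Suc j) (R k))) (Xj (Suc j))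
          = hs_inner (nd d) ({..<n} \<times> after j) (tens n (after j) (\<lambda>k. ptrace d {RX (Suc j)} (R k))) (Xj j)"
    by (rule strategy_unroll[OF st r], rule that)
  have Rpsd: "psd d (before j) (R k j)" if "k < n" "j \<in> {1..r}" for k j
    by (rule dual_chain_psd[OF R M d]) (use that in auto)
  let ?V = "\<lambda>j. Re (hs_inner (nd d) ({..<n} \<times> after j) (tens n (after j) (\<lambda>k. ext_id j (R k j))) (Xj j))"
  have "?V r \<le> (\<Prod>k<n. Re (tr d (Xs 1) (R k 1)))"
    using r
  proof (induction r rule: dec_induct)
    case base
    \<comment> \<open>The traces are real by positivity; otherwise the real part of the product need
      not be the product of the real parts.\<close>
    have "cnj (tr d (Xs 1) (R k 1)) = of_real (Re (tr d (Xs 1) (R k 1)))" if "k < n" for k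
    proof -
      have "psd d (Xs 1) (R k 1)" using Rpsd[OF that, of 1] r by simp
      then have "tr d (Xs 1) (R k 1) \<in> \<real>\<^sub>\<ge>\<^sub>0" by (intro tr_psd) auto
      then show ?thesis by (simp add: complex_eq_iff complex_nonneg_Reals_iff)
    qed
    then have "(\<Prod>k<n. cnj (tr d (Xs 1) (R k 1))) = of_real (\<Prod>k<n. Re (tr d (Xs 1) (R k 1)))"
      by (simp add: of_real_prod)
    then show ?case by (simp only: one Re_complex_of_real order_refl)
  next
    case (step j)
    have j: "j \<in> {1..<r}" using step by auto
    have be: "before (Suc j) = after j \<union> {RX (Suc j)}" and ad: "after j \<inter> {RX (Suc j)} = {}"
      using before_eq[of "Suc j"] after_disjoint[of "Suc j"] by simp_all
    have "?V (Suc j) \<le> ?V j"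
      unfolding unroll[OF j]
    proof (rule hs_inner_tens_mono)
      fix k assume k: "k < n"
      show "psd d (after j) (ptrace d {RX (Suc j)} (R k (Suc j)))"
        using psd_ptrace[OF ad] Rpsd[OF k, of "Suc j"] j be by simp
      show "psd d (after j) (\<lambda>a b. ext_id j (R k j) a b - ptrace d {RX (Suc j)} (R k (Suc j)) a b)"
        using R[OF k] j by (simp add: dual_chain_def)
    qed (use Xj j in auto)
    then show ?case using step.IH by simp
  qed
  moreover have "Re (hs_inner (nd d) ({..<n} \<times> after r) (tens n (after r) M) (Xj r)) \<le> ?V r"
    by (rule hs_inner_tens_mono) (use Xj(2)[of r] r M R in \<open>auto simp: dual_chain_def\<close>)
  ultimately show ?thesis using Xj(1) by simp
qed

text \<open>Round 0 is a dummy round with the scalar strategy 1, so that all rounds have the same constraint.\<close>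

definition chain :: "nat \<Rightarrow> (reg \<Rightarrow> nat) \<Rightarrow> (nat \<Rightarrow> reg op) \<Rightarrow> bool" where
  "chain r d X \<longleftrightarrow> X 0 = (\<lambda>_ _. 1) \<and>
     (\<forall>j\<in>{1..r}. psd d (after j) (X j)) \<and>
     (\<forall>j\<in>{1..r}. op_eq d (before j) (ptrace d {RY j} (X j)) (tensor (after (j - 1)) {RX j} (X (j - 1)) idop))"

text \<open>With the dummy round, the constraint of round 1 reads as in
  \<open>strategy\<close>.\<close>

lemma tensor_empty_one: "op_eq d (Xs 1) (tensor {} {RX 1} (\<lambda>_ _. 1) idop) idop"
proof -
  have X1: "Xs 1 = {RX 1}" using Xs_insert[of 1] by simp
  have "restrict a {RX 1} = a" if "a \<in> cfgs d {RX 1}" for a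
    using that unfolding cfgs_def by (rule PiE_restrict)
  then show ?thesis unfolding X1 op_eq_def tensor_def by simp
qed

text \<open>Independent play of all copies. The case \<open>n = 1\<close> turns a
  \<open>chain\<close> into a 1-fold strategy.\<close>

lemma chain_imp_strategy:
  assumes "chain r d X" "r \<ge> 1"
  shows "strategy n r d (tens n (after r) (\<lambda>_. X r))"
  unfolding strategy_def copies_after copies_before
proof (intro exI[of _ "\<lambda>j. tens n (after j) (\<lambda>_. X j)"] conjI ballI refl)
  fix j assume "j \<in> {1..r}"
  then show "psd (nd d) ({..<n} \<times> after j) (tens n (after j) (\<lambda>_. X j))"
    using assms by (intro psd_tens) (auto simp: chain_def)
next
  have Y1: "Ys 1 = {RY 1}" using Ys_insert[of 1] by simp
  have 1: "ptrace (nd d) (nYs n 1) (tens n (after 1) (\<lambda>_. X 1)) = tens n (Xs 1) (\<lambda>_. ptrace d (Ys 1) (X 1))"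
    unfolding nYs_def Un_commute[of "Ys 1"] by (rule ptrace_tens) (auto simp: Xs_def Ys_def)
  have 2: "op_eq (nd d) (nXs n 1) (tens n (Xs 1) (\<lambda>_. ptrace d (Ys 1) (X 1))) (tens n (Xs 1) (\<lambda>_. idop))"
  proof -
    have "op_eq d (Xs 1) (ptrace d {RY 1} (X 1)) (tensor {} {RX 1} (X 0) idop)"
      using assms by (auto simp: chain_def dest!: bspec[of _ _ 1])
    moreover have "op_eq d (Xs 1) (tensor {} {RX 1} (X 0) idop) idop"
      using assms(1) tensor_empty_one by (simp add: chain_def)
    ultimately show ?thesis unfolding nXs_def Y1 by (intro tens_cong) (auto simp: op_eq_def)
  qed
  have 3: "op_eq (nd d) (nXs n 1) (tens n (Xs 1) (\<lambda>_. idop)) idop"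
    unfolding nXs_def by (rule tens_idop)
  show "op_eq (nd d) (nXs n 1) (ptrace (nd d) (nYs n 1) (tens n (after 1) (\<lambda>_. X 1))) idop"
    unfolding 1 by (rule op_eq_trans[OF 2 3])
next
  fix j assume j: "j \<in> {2..r}"
  then have j1: "j \<ge> 1" "j \<in> {1..r}" by auto
  have 1: "ptrace (nd d) ({..<n} \<times> {RY j}) (tens n (after j) (\<lambda>_. X j)) = tens n (before j) (\<lambda>_. ptrace d {RY j} (X j))"
    unfolding after_eq[OF j1(1)] by (rule ptrace_tens) (use before_disjoint[OF j1(1)] in auto)
  have 2: "op_eq (nd d) ({..<n} \<times> before j) (tens n (before j) (\<lambda>_. ptrace d {RY j} (X j))) (tens n (before j) (\<lambda>_. tensor (after (j - 1)) {RX j} (X (j - 1)) idop))"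
    using assms j1 by (intro tens_cong) (auto simp: chain_def)
  have 3: "op_eq (nd d) ({..<n} \<times> before j) (tens n (before j) (\<lambda>_. tensor (after (j - 1)) {RX j} (X (j - 1)) idop))
      (tensor ({..<n} \<times> after (j - 1)) ({..<n} \<times> {RX j}) (tens n (after (j - 1)) (\<lambda>_. X (j - 1))) idop)"
    unfolding before_eq[OF j1(1)] by (rule tens_tensor_idop)
  show "op_eq (nd d) ({..<n} \<times> before j) (ptrace (nd d) ({..<n} \<times> {RY j}) (tens n (after j) (\<lambda>_. X j)))
      (tensor ({..<n} \<times> after (j - 1)) ({..<n} \<times> {RX j}) (tens n (after (j - 1)) (\<lambda>_. X (j - 1))) idop)"
    unfolding 1 by (rule op_eq_trans[OF 2 3])
qed

section \<open>Lagrange multipliers over compact convex sets\<close>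

text \<open>In the plane, the points (g x, f x) form a convex set missing the ray above (0, b +
  \<delta>), and a line of slope \<open>y\<close> through that point must stay above the set.
  Convexity enters only through the operation \<open>mix\<close>, on which \<open>f\<close> and
  \<open>g\<close> are affine.\<close>

lemma lagrange_multiplier_pos:
  fixes f g :: "'a::topological_space \<Rightarrow> real" and mix :: "real \<Rightarrow> 'a \<Rightarrow> 'a \<Rightarrow> 'a"
  assumes K: "compact K" and f: "continuous_on K f" and g: "continuous_on K g"
    and mix: "\<And>t x z. 0 \<le> t \<Longrightarrow> t \<le> 1 \<Longrightarrow> x \<in> K \<Longrightarrow> z \<in> K \<Longrightarrow> mix t x z \<in> K"
    and fmix: "\<And>t x z. x \<in> K \<Longrightarrow> z \<in> K \<Longrightarrow> f (mix t x z) = (1 - t) * f x + t * f z"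
    and gmix: "\<And>t x z. x \<in> K \<Longrightarrow> z \<in> K \<Longrightarrow> g (mix t x z) = (1 - t) * g x + t * g z"
    and b: "\<And>x. x \<in> K \<Longrightarrow> g x = 0 \<Longrightarrow> f x \<le> b" and \<delta>: "\<delta> > 0"
    and ne: "x1 \<in> K" "f x1 \<ge> b + \<delta>" "g x1 \<ge> 0"
  shows "\<exists>y. \<forall>x\<in>K. f x - y * g x \<le> b + \<delta>"
proof -
  define P where "P = {x \<in> K. f x \<ge> b + \<delta>} \<inter> {x \<in> K. g x \<ge> 0}"
  have "closedin (top_of_set K) {x \<in> K. f x \<ge> b + \<delta>}" "closedin (top_of_set K) {x \<in> K. g x \<ge> 0}"
    using continuous_closedin_preimage[OF f, of "{b + \<delta>..}"] continuous_closedin_preimage[OF g, of "{0..}"]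
    by (auto simp: vimage_def Int_def)
  then have "closedin (top_of_set K) P" unfolding P_def by (rule closedin_Int)
  then have cP: "compact P" using K closedin_compact by blast
  have PK: "P \<subseteq> K" by (auto simp: P_def)
  \<comment> \<open>The slack \<delta> > 0 keeps \<open>g\<close> away from 0 on \<open>P\<close>,
    so the slope is a continuous function on a compact set.\<close>
  have gP: "g x > 0" if "x \<in> P" for x
    using that b[of x] \<delta> by (cases "g x = 0") (auto simp: P_def)
  have "continuous_on P (\<lambda>x. (f x - (b + \<delta>)) / g x)"
    using continuous_on_subset[OF f PK] continuous_on_subset[OF g PK] gP
    by (intro continuous_intros) (auto dest!: gP)
  moreover have "P \<noteq> {}" using ne by (auto simp: P_def)
  ultimately obtain x0 where x0: "x0 \<in> P"
    and max: "\<And>x. x \<in> P \<Longrightarrow> (f x - (b + \<delta>)) / g x \<le> (f x0 - (b + \<delta>)) / g x0"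
    using continuous_attains_sup[OF cP] by blast
  \<comment> \<open>The steepest slope from (0, b + \<delta>) to a point of
    \<open>P\<close>.\<close>
  define y where "y = (f x0 - (b + \<delta>)) / g x0"
  have g0: "g x0 > 0" by (rule gP[OF x0])
  have y0: "y \<ge> 0" using x0 g0 by (auto simp: y_def P_def)
  have yg: "y * g x0 = f x0 - (b + \<delta>)" using g0 by (simp add: y_def)
  have "f x - y * g x \<le> b + \<delta>" if x: "x \<in> K" for x
  proof (cases "g x \<ge> 0")
    case True
    show ?thesis
    proof (cases "f x \<ge> b + \<delta>")
      case f: True
      then have P: "x \<in> P" using x True by (simp add: P_def)
      then have "(f x - (b + \<delta>)) / g x \<le> y" unfolding y_def by (rule max)
      then show ?thesis using gP[OF P] by (simp add: field_simps)
    next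
      case False
      moreover have "y * g x \<ge> 0" using y0 True by simp
      ultimately show ?thesis by simp
    qed
  next
    case False
    \<comment> \<open>The weight at which the segment from \<open>x0\<close> to \<open>x\<close>
      crosses \<open>g = 0\<close>, where \<open>f\<close> is at most \<open>b\<close>.\<close>
    define t where "t = g x0 / (g x0 - g x)"
    have den: "g x0 - g x > 0" using False g0 by simp
    have t: "0 \<le> t" "t \<le> 1" using False g0 by (auto simp: t_def field_simps)
    have xK: "x0 \<in> K" using x0 PK by blast
    have tg: "(1 - t) * (g x0 - g x) = - g x" "t * (g x0 - g x) = g x0"
      using den by (simp_all add: t_def field_simps)
    have "(1 - t) * g x0 + t * g x = 0" using tg by (simp add: algebra_simps)
    then have "(1 - t) * f x0 + t * f x \<le> b"
      using b[OF mix[OF t xK x]] fmix[OF xK x, of t] gmix[OF xK x, of t] by simp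
    then have "((1 - t) * f x0 + t * f x) * (g x0 - g x) \<le> b * (g x0 - g x)"
      using den by (intro mult_right_mono) auto
    also have "((1 - t) * f x0 + t * f x) * (g x0 - g x)
        = ((1 - t) * (g x0 - g x)) * f x0 + (t * (g x0 - g x)) * f x"
      by (simp add: algebra_simps)
    also have "\<dots> = - g x * f x0 + g x0 * f x" by (simp only: tg)
    finally have "g x0 * f x - g x * f x0 \<le> b * (g x0 - g x)" by simp
    moreover have "\<delta> * (g x0 - g x) \<ge> 0" using \<delta> den by simp
    ultimately have "g x0 * f x - g x * f x0 \<le> (b + \<delta>) * (g x0 - g x)"
      by (simp add: algebra_simps)
    moreover have "g x0 * (f x - y * g x) = g x0 * f x - (y * g x0) * g x"
      by (simp add: algebra_simps)
    ultimately have "g x0 * (f x - y * g x) \<le> g x0 * (b + \<delta>)"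
      unfolding yg by (simp add: algebra_simps)
    then show ?thesis using g0 by simp
  qed
  then show ?thesis by blast
qed

text \<open>A point above the bound with \<open>g < 0\<close> is treated by replacing
  \<open>g\<close> by \<open>- g\<close>; if no point lies above the bound, the multiplier 0
  works.\<close>

lemma lagrange_multiplier:
  fixes f g :: "'a::topological_space \<Rightarrow> real" and mix :: "real \<Rightarrow> 'a \<Rightarrow> 'a \<Rightarrow> 'a"
  assumes K: "compact K" and f: "continuous_on K f" and g: "continuous_on K g"
    and mix: "\<And>t x z. 0 \<le> t \<Longrightarrow> t \<le> 1 \<Longrightarrow> x \<in> K \<Longrightarrow> z \<in> K \<Longrightarrow> mix t x z \<in> K"
    and fmix: "\<And>t x z. x \<in> K \<Longrightarrow> z \<in> K \<Longrightarrow> f (mix t x z) = (1 - t) * f x + t * f z"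
    and gmix: "\<And>t x z. x \<in> K \<Longrightarrow> z \<in> K \<Longrightarrow> g (mix t x z) = (1 - t) * g x + t * g z"
    and b: "\<And>x. x \<in> K \<Longrightarrow> g x = 0 \<Longrightarrow> f x \<le> b" and \<delta>: "\<delta> > 0"
  shows "\<exists>y. \<forall>x\<in>K. f x - y * g x \<le> b + \<delta>"
proof (cases "\<exists>x\<in>K. f x \<ge> b + \<delta>")
  case True
  then obtain x1 where x1: "x1 \<in> K" "f x1 \<ge> b + \<delta>" by blast
  show ?thesis
  proof (cases "g x1 \<ge> 0")
    case True
    show ?thesis
      by (rule lagrange_multiplier_pos[where mix = mix, OF K f g mix fmix gmix b \<delta> x1 True])
  next
    case False
    have "\<exists>y. \<forall>x\<in>K. f x - y * (- g x) \<le> b + \<delta>"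
      by (rule lagrange_multiplier_pos[where mix = mix and g = "\<lambda>x. - g x", OF K f _ mix fmix _ _ \<delta> x1])
        (use g gmix b False in \<open>auto intro: continuous_intros simp: algebra_simps\<close>)
    then obtain y where "\<forall>x\<in>K. f x - y * (- g x) \<le> b + \<delta>" by blast
    then show ?thesis by (intro exI[of _ "- y"]) simp
  qed
next
  case False
  then show ?thesis by (intro exI[of _ 0]) force
qed

text \<open>One constraint is first kept by shrinking \<open>K\<close> to its zero set while the
  others get multipliers; it is then released for the resulting Lagrangian. Each stage spends half
  of \<delta>.\<close>

lemma lagrange_multipliers:
  fixes f :: "'a::topological_space \<Rightarrow> real" and mix :: "real \<Rightarrow> 'a \<Rightarrow> 'a \<Rightarrow> 'a"
  assumes "finite J" and "compact K" and "continuous_on K f" and "\<And>j. j \<in> J \<Longrightarrow> continuous_on K (g j)"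
    and "\<And>t x z. 0 \<le> t \<Longrightarrow> t \<le> 1 \<Longrightarrow> x \<in> K \<Longrightarrow> z \<in> K \<Longrightarrow> mix t x z \<in> K"
    and "\<And>t x z. x \<in> K \<Longrightarrow> z \<in> K \<Longrightarrow> f (mix t x z) = (1 - t) * f x + t * f z"
    and "\<And>j t x z. j \<in> J \<Longrightarrow> x \<in> K \<Longrightarrow> z \<in> K \<Longrightarrow> g j (mix t x z) = (1 - t) * g j x + t * g j z"
    and "\<And>x. x \<in> K \<Longrightarrow> (\<And>j. j \<in> J \<Longrightarrow> g j x = 0) \<Longrightarrow> f x \<le> b" and "\<delta> > 0"
  shows "\<exists>y. \<forall>x\<in>K. f x - (\<Sum>j\<in>J. y j * g j x) \<le> b + \<delta>"
  using assms
proof (induction J arbitrary: K \<delta> rule: finite_induct)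
  case empty
  then show ?case by force
next
  case (insert i J)
  note prems = insert.prems
  define K' where "K' = {x \<in> K. g i x = 0}"
  have K'K: "K' \<subseteq> K" by (auto simp: K'_def)
  have "closedin (top_of_set K) K'"
    using prems(3)[of i] continuous_closedin_preimage[of K "g i" "{0}"]
    by (auto simp: K'_def vimage_def Int_def)
  then have "compact K'" using prems(1) closedin_compact by blast
  then have "\<exists>y. \<forall>x\<in>K'. f x - (\<Sum>j\<in>J. y j * g j x) \<le> b + \<delta> / 2"
  proof (rule insert.IH)
    show "mix t x z \<in> K'" if "0 \<le> t" "t \<le> 1" "x \<in> K'" "z \<in> K'" for t x z
      using that prems(4)[of t x z] prems(6)[of i x z t] by (auto simp: K'_def)
    show "f x \<le> b" if "x \<in> K'" "\<And>j. j \<in> J \<Longrightarrow> g j x = 0" for x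
      using that prems(7)[of x] by (auto simp: K'_def)
    show "f (mix t x z) = (1 - t) * f x + t * f z" if "x \<in> K'" "z \<in> K'" for t x z
      using prems(5) K'K that by blast
    show "g j (mix t x z) = (1 - t) * g j x + t * g j z" if "j \<in> J" "x \<in> K'" "z \<in> K'" for j t x z
      using prems(6) K'K that by blast
  qed (use prems K'K in \<open>auto intro: continuous_on_subset\<close>)
  then obtain y where y: "\<And>x. x \<in> K' \<Longrightarrow> f x - (\<Sum>j\<in>J. y j * g j x) \<le> b + \<delta> / 2" by blast
  define h where "h x = f x - (\<Sum>j\<in>J. y j * g j x)" for x
  have "\<exists>c. \<forall>x\<in>K. h x - c * g i x \<le> (b + \<delta> / 2) + \<delta> / 2"
  proof (rule lagrange_multiplier[where mix = mix])
    show "continuous_on K h" unfolding h_def using prems(2,3) by (intro continuous_intros) auto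
    show "h (mix t x z) = (1 - t) * h x + t * h z" if "x \<in> K" "z \<in> K" for t x z
    proof -
      have "(\<Sum>j\<in>J. y j * g j (mix t x z)) = (\<Sum>j\<in>J. (1 - t) * (y j * g j x) + t * (y j * g j z))"
        by (intro sum.cong refl) (simp add: prems(6) that algebra_simps)
      also have "\<dots> = (1 - t) * (\<Sum>j\<in>J. y j * g j x) + t * (\<Sum>j\<in>J. y j * g j z)"
        by (simp only: sum.distrib sum_distrib_left)
      finally show ?thesis by (simp add: h_def prems(5)[OF that] algebra_simps)
    qed
    show "h x \<le> b + \<delta> / 2" if "x \<in> K" "g i x = 0" for x
      using y[of x] that by (simp add: h_def K'_def)
  qed (use prems in auto)
  then obtain c where c: "\<And>x. x \<in> K \<Longrightarrow> h x - c * g i x \<le> b + \<delta>"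
    by (simp only: add.assoc field_sum_of_halves) blast
  show ?case
  proof (intro exI[of _ "y(i := c)"] ballI)
    fix x assume x: "x \<in> K"
    have "(\<Sum>j\<in>J. (y(i := c)) j * g j x) = (\<Sum>j\<in>J. y j * g j x)"
      using insert.hyps by (intro sum.cong) auto
    then show "f x - (\<Sum>j\<in>insert i J. (y(i := c)) j * g j x) \<le> b + \<delta>"
      using c[OF x] insert.hyps by (simp add: h_def algebra_simps)
  qed
qed

section \<open>Strong duality\<close>

text \<open>This is Tychonoff's theorem. Operators are indexed by all functions, not only by
  configurations, so there may be infinitely many coordinates.\<close>

lemma compact_cube: "compact {x :: 'i \<Rightarrow> complex. \<forall>i. cmod (x i) \<le> B}"
proof -
  have "compactin (product_topology (\<lambda>_. euclidean) UNIV) (PiE UNIV (\<lambda>_::'i. cball (0::complex) B))"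
    unfolding compactin_PiE by (simp add: compactin_euclidean_iff)
  then have "compact (PiE UNIV (\<lambda>_::'i. cball (0::complex) B))"
    by (simp add: euclidean_product_topology compactin_euclidean_iff)
  moreover have "PiE UNIV (\<lambda>_::'i. cball (0::complex) B) = {x. \<forall>i. cmod (x i) \<le> B}"
    by (auto simp: PiE_iff)
  ultimately show ?thesis by simp
qed

lemma continuous_on_hs_inner [continuous_intros]:
  fixes F :: "'a::topological_space \<Rightarrow> 'l op"
  assumes "\<And>a b. continuous_on S (\<lambda>x. F x a b)"
  shows "continuous_on S (\<lambda>x. hs_inner d T A (F x))"
  unfolding hs_inner_def by (intro continuous_intros assms)

lemma hs_inner_adjoint_rank_one:
  "hs_inner d S (\<lambda>a b. v a * cnj (v b)) (\<lambda>a b. cnj (A b a)) = cnj (hs_inner d S (\<lambda>a b. v a * cnj (v b)) A)"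
  unfolding hs_inner_def cnj_sum by (subst sum.swap) (simp add: mult_ac)

lemma hs_inner_rank_one_idop:
  assumes "finite S"
  shows "hs_inner d S (\<lambda>a b. v a * cnj (v b)) idop = of_real (\<Sum>a\<in>cfgs d S. (cmod (v a))\<^sup>2)"
  unfolding hs_inner_idop[OF assms] tr_def of_real_sum complex_norm_square cnj_sum
  by (simp add: mult.commute)

text \<open>Multipliers are arbitrary matrices, and the Lagrangian controls only the real part of
  the form, that is the Hermitian part. The multiple of the identity covers the deficit
  \<eta>.\<close>

lemma psd_hermitian_part_shift:
  fixes D :: "'l op"
  assumes "finite S"
    and D: "\<And>v. Re (hs_inner d S D (\<lambda>a b. v a * cnj (v b))) \<ge> - \<eta> * (\<Sum>a\<in>cfgs d S. (cmod (v a))\<^sup>2)"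
    and "\<eta> \<le> \<kappa>"
  shows "psd d S (\<lambda>a b. (D a b + cnj (D b a)) / 2 + of_real \<kappa> * idop a b)"
  unfolding psd_iff_hs_inner
proof
  fix v :: "('l \<Rightarrow> nat) \<Rightarrow> complex"
  let ?v = "\<lambda>a b. v a * cnj (v b)"
  let ?n = "\<Sum>a\<in>cfgs d S. (cmod (v a))\<^sup>2"
  have "hs_inner d S ?v (\<lambda>a b. (D a b + cnj (D b a)) / 2 + of_real \<kappa> * idop a b)
     = hs_inner d S ?v (\<lambda>a b. (1/2) * (D a b + cnj (D b a)) + of_real \<kappa> * idop a b)" by simp
  also have "\<dots> = (1/2) * (hs_inner d S ?v D + cnj (hs_inner d S ?v D)) + of_real \<kappa> * of_real ?n"
    by (simp only: hs_inner_add_right hs_inner_scale_right hs_inner_adjoint_rank_one hs_inner_rank_one_idop[OF assms(1)])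
  also have "\<dots> = of_real (Re (hs_inner d S D ?v) + \<kappa> * ?n)"
    by (simp add: complex_eq_iff cnj_hs_inner[of d S ?v D, symmetric] flip: of_real_mult)
  finally have *: "hs_inner d S ?v (\<lambda>a b. (D a b + cnj (D b a)) / 2 + of_real \<kappa> * idop a b)
     = of_real (Re (hs_inner d S D ?v) + \<kappa> * ?n)" .
  have "\<eta> * ?n \<le> \<kappa> * ?n" using assms(3) by (intro mult_right_mono sum_nonneg) auto
  then have "Re (hs_inner d S D ?v) + \<kappa> * ?n \<ge> 0" using D[of v] by linarith
  then show "hs_inner d S ?v (\<lambda>a b. (D a b + cnj (D b a)) / 2 + of_real \<kappa> * idop a b) \<in> \<real>\<^sub>\<ge>\<^sub>0"
    unfolding * by (simp only: nonneg_Reals_of_real_iff)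
qed

lemma tensor_idop_idop:
  assumes "a \<in> cfgs d (S \<union> T)" "b \<in> cfgs d (S \<union> T)"
  shows "tensor S T idop idop a b = idop a b"
proof -
  have "a = b" if "restrict a S = restrict b S" "restrict a T = restrict b T"
  proof
    fix l show "a l = b l"
      using that assms by (cases "l \<in> S \<union> T") (auto simp: cfgs_def PiE_iff extensional_def dest: fun_cong[of _ _ l])
  qed
  then show ?thesis by (auto simp: tensor_def idop_def)
qed

lemma ptrace_idop:
  assumes "S \<inter> T = {}" "finite T" "a \<in> cfgs d S" "b \<in> cfgs d S"
  shows "ptrace d T idop a b = of_nat (card (cfgs d T)) * idop a b"
proof -
  have "join a c T = join b c T \<longleftrightarrow> a = b" for c
    using restrict_join_left[OF assms(3,1), of c] restrict_join_left[OF assms(4,1), of c] by metis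
  then show ?thesis by (simp add: ptrace_def idop_def)
qed

text \<open>The multiplier \<open>R j\<close> belongs to the constraint of round \<open>j\<close>; the left-hand side is the Lagrangian
  with the adjoints of the constraint maps applied to the multipliers.\<close>

lemma approximate_multipliers:
  assumes r: "r \<ge> 1" and \<delta>: "\<delta> > 0" and B: "B \<ge> 1"
    and bd: "\<forall>X. chain r d X \<longrightarrow> Re (hs_inner d (after r) M (X r)) \<le> b"
  shows "\<exists>R. \<forall>X. X 0 = (\<lambda>_ _. 1) \<longrightarrow> (\<forall>j a c. cmod (X j a c) \<le> B) \<longrightarrow> (\<forall>j\<in>{1..r}. psd d (after j) (X j)) \<longrightarrow>
     Re (tr d (Xs 1) (R 1)) - (\<Sum>j=1..r. Re (hs_inner d (after j)
        (\<lambda>a c. ext_id j (R j) a c - (if j = r then M else ptrace d {RX (Suc j)} (R (Suc j))) a c) (X j))) \<le> b + \<delta>"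
proof -
  \<comment> \<open>All rounds are packed into one function of (round, row, column), so that the
    product topology applies.\<close>
  define op :: "(nat \<times> (reg \<Rightarrow> nat) \<times> (reg \<Rightarrow> nat) \<Rightarrow> complex) \<Rightarrow> nat \<Rightarrow> reg op"
    where "op x j a c = x (j, a, c)" for x j a c
  define K where "K = {x. \<forall>i. cmod (x i) \<le> B} \<inter>
     {x. op x 0 = (\<lambda>_ _. 1) \<and> (\<forall>j\<in>{1..r}. psd d (after j) (op x j))}"
  define E where "E x j a c = ptrace d {RY j} (op x j) a c - tensor (after (j - 1)) {RX j} (op x (j - 1)) idop a c" for x j a c
  \<comment> \<open>Each matrix entry of each constraint gives two real ones; the Boolean selects
    the real or the imaginary part.\<close>
  define g where "g = (\<lambda>(j, a, c, s) x. if s then Re (E x j a c) else Im (E x j a c))"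
  define J where "J = (SIGMA j:{1..r}. cfgs d (before j) \<times> cfgs d (before j) \<times> (UNIV :: bool set))"
  define f where "f x = Re (hs_inner d (after r) M (op x r))" for x
  define mix where "mix t x z = (\<lambda>i. of_real (1 - t) * x i + of_real t * z i :: complex)"
    for t x and z :: "nat \<times> (reg \<Rightarrow> nat) \<times> (reg \<Rightarrow> nat) \<Rightarrow> complex"
  have opmix: "op (mix t x z) j = (\<lambda>a c. of_real (1 - t) * op x j a c + of_real t * op z j a c)" for t x z j
    by (simp add: op_def mix_def fun_eq_iff)
  have cont: "continuous_on S (\<lambda>x. op x j a c)" for S j a c
    unfolding op_def by (rule continuous_on_subset[OF continuous_on_product_coordinates]) simp
  have contE: "continuous_on S (\<lambda>x. E x j a c)" for S j a c
    unfolding E_def ptrace_def tensor_def by (intro continuous_intros cont)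
  have Emix: "E (mix t x z) j a c = of_real (1 - t) * E x j a c + of_real t * E z j a c" for t x z j a c
    unfolding E_def opmix ptrace_def tensor_def sum.distrib sum_distrib_left[symmetric]
    by (simp only: ring_distribs right_diff_distrib mult.assoc) simp
  have "closed {x. op x 0 = (\<lambda>_ _. 1) \<and> (\<forall>j\<in>{1..r}. psd d (after j) (op x j))}"
    unfolding fun_eq_iff psd_iff_hs_inner complex_nonneg_Reals_iff Ball_def
    by (intro closed_Collect_conj closed_Collect_all closed_Collect_imp closed_Collect_eq closed_Collect_le
        open_Collect_const continuous_intros cont)
  then have compK: "compact K" unfolding K_def by (intro compact_Int_closed compact_cube)
  have finJ: "finite J" unfolding J_def by (intro finite_SigmaI finite_cartesian_product) auto
  have "\<exists>y. \<forall>x\<in>K. f x - (\<Sum>i\<in>J. y i * g i x) \<le> b + \<delta>"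
  proof (rule lagrange_multipliers[where mix = mix, OF finJ compK])
    show "continuous_on K f" unfolding f_def by (intro continuous_intros cont)
    show "continuous_on K (g i)" for i
    proof -
      obtain j a c s where i: "i = (j, a, c, s)" by (cases i)
      show ?thesis unfolding i g_def by (cases s) (auto intro!: continuous_intros contE)
    qed
    show "mix t x z \<in> K" if t: "0 \<le> t" "t \<le> 1" and xz: "x \<in> K" "z \<in> K" for t x z
    proof -
      have "cmod (mix t x z i) \<le> B" for i
      proof -
        have "cmod (mix t x z i) \<le> (1 - t) * cmod (x i) + t * cmod (z i)"
          unfolding mix_def by (rule order_trans[OF norm_triangle_ineq]) (use t in \<open>simp add: norm_mult del: of_real_diff\<close>)
        also have "\<dots> \<le> (1 - t) * B + t * B"
          using t xz by (cases i) (intro add_mono mult_left_mono, auto simp: K_def)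
        finally show ?thesis by (simp add: algebra_simps)
      qed
      moreover have "psd d (after j) (op (mix t x z) j)" if "j \<in> {1..r}" for j
        unfolding opmix by (intro psd_add psd_scale) (use that t xz in \<open>auto simp: K_def\<close>)
      moreover have "op (mix t x z) 0 = (\<lambda>_ _. 1)"
        using xz by (simp add: opmix K_def)
      ultimately show ?thesis by (simp add: K_def)
    qed
    show "f (mix t x z) = (1 - t) * f x + t * f z" for t x z
      unfolding f_def opmix hs_inner_add_right hs_inner_scale_right by simp
    show "g i (mix t x z) = (1 - t) * g i x + t * g i z" for i t x z
      by (cases i) (simp add: g_def Emix)
    show "f x \<le> b" if x: "x \<in> K" and g: "\<And>i. i \<in> J \<Longrightarrow> g i x = 0" for x
    proof -
      have "E x j a c = 0" if "j \<in> {1..r}" "a \<in> cfgs d (before j)" "c \<in> cfgs d (before j)" for j a c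
        using g[of "(j, a, c, True)"] g[of "(j, a, c, False)"] that
        by (simp add: J_def g_def complex_eq_iff)
      then have "chain r d (op x)" using x by (simp add: chain_def op_eq_def E_def K_def)
      then show ?thesis using bd by (simp add: f_def)
    qed
  qed (rule \<delta>)
  then obtain y where y: "\<And>x. x \<in> K \<Longrightarrow> f x - (\<Sum>i\<in>J. y i * g i x) \<le> b + \<delta>" by blast
  \<comment> \<open>The two real multipliers of an entry become one complex entry; the conjugation
    in \<open>hs_inner\<close> makes the real part of the pairing their weighted sum.\<close>
  define R where "R j a c = Complex (y (j, a, c, True)) (y (j, a, c, False))" for j a c
  have ysum: "(\<Sum>i\<in>J. y i * g i x) = (\<Sum>j=1..r. Re (hs_inner d (before j) (R j) (E x j)))" for x
  proof -
    have "(\<Sum>i\<in>J. y i * g i x) = (\<Sum>j=1..r. \<Sum>(a, c, s)\<in>cfgs d (before j) \<times> cfgs d (before j) \<times> UNIV. y (j, a, c, s) * g (j, a, c, s) x)"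
      unfolding J_def by (subst sum.Sigma) (auto simp: case_prod_beta)
    also have "\<dots> = (\<Sum>j=1..r. \<Sum>a\<in>cfgs d (before j). \<Sum>c\<in>cfgs d (before j). \<Sum>s\<in>UNIV. y (j, a, c, s) * g (j, a, c, s) x)"
      by (simp only: sum.cartesian_product[symmetric])
    also have "\<dots> = (\<Sum>j=1..r. Re (hs_inner d (before j) (R j) (E x j)))"
      by (simp add: UNIV_bool g_def hs_inner_def R_def add_ac)
    finally show ?thesis .
  qed
  have "Re (tr d (Xs 1) (R 1)) - (\<Sum>j=1..r. Re (hs_inner d (after j)
        (\<lambda>a c. ext_id j (R j) a c - (if j = r then M else ptrace d {RX (Suc j)} (R (Suc j))) a c) (X j))) \<le> b + \<delta>"
    if X: "X 0 = (\<lambda>_ _. 1)" "\<forall>j a c. cmod (X j a c) \<le> B" "\<forall>j\<in>{1..r}. psd d (after j) (X j)" for X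
  proof -
    define x where "x = (\<lambda>(j, a, c). X j a c)"
    have op: "op x = X" by (simp add: op_def x_def fun_eq_iff)
    have xK: "x \<in> K" using X by (auto simp: K_def op) (simp add: x_def)
    \<comment> \<open>The constraint of round \<open>Suc j\<close> contributes
      \<open>P (Suc j) - Q j\<close>. Regrouped by \<open>X j\<close> this is
      \<open>P j - Q j\<close>, leaving \<open>Q 0\<close>, the trace, at the start and the
      objective at the end.\<close>
    define P where "P j = Re (hs_inner d (after j) (ext_id j (R j)) (X j))" for j
    define Q where "Q j = Re (hs_inner d (after j) (ptrace d {RX (Suc j)} (R (Suc j))) (X j))" for j
    have Ej: "Re (hs_inner d (before (Suc j)) (R (Suc j)) (E x (Suc j))) = P (Suc j) - Q j" for j
    proof -
      have be: "before (Suc j) = after j \<union> {RX (Suc j)}" and ad: "after j \<inter> {RX (Suc j)} = {}"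
        using before_eq[of "Suc j"] after_disjoint[of "Suc j"] by simp_all
      have "hs_inner d (before (Suc j)) (R (Suc j)) (tensor (after j) {RX (Suc j)} (X j) idop)
          = hs_inner d (after j) (ptrace d {RX (Suc j)} (R (Suc j))) (X j)"
        unfolding be by (rule hs_inner_tensor_idop_right[OF ad]) simp
      moreover have "E x (Suc j) = (\<lambda>a c. ptrace d {RY (Suc j)} (X (Suc j)) a c - tensor (after j) {RX (Suc j)} (X j) idop a c)"
        by (simp add: E_def op fun_eq_iff)
      ultimately show ?thesis
        using hs_inner_ext_id[of "Suc j" d "R (Suc j)" "X (Suc j)"] by (simp add: P_def Q_def hs_inner_diff_right)
    qed
    have Q0: "Q 0 = Re (tr d (Xs 1) (R 1))"
    proof -
      have X1: "Xs 1 = {} \<union> {RX 1}" using Xs_insert[of 1] by simp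
      have "hs_inner d (Xs 1) (R 1) (tensor {} {RX 1} (X 0) idop) = hs_inner d {} (ptrace d {RX 1} (R 1)) (X 0)"
        unfolding X1 by (rule hs_inner_tensor_idop_right) auto
      moreover have "hs_inner d (Xs 1) (R 1) (tensor {} {RX 1} (X 0) idop) = hs_inner d (Xs 1) (R 1) idop"
        unfolding X(1) by (intro hs_inner_cong op_eq_refl tensor_empty_one)
      ultimately show ?thesis by (simp add: Q_def hs_inner_idop)
    qed
    have Dj: "Re (hs_inner d (after j) (\<lambda>a c. ext_id j (R j) a c - (if j = r then M else ptrace d {RX (Suc j)} (R (Suc j))) a c) (X j))
        = P j - (if j = r then f x else Q j)" for j
      unfolding hs_inner_diff_left by (simp add: P_def Q_def f_def op)
    have sh: "(\<Sum>j=1..r. h j) = (\<Sum>j<r. h (Suc j))" for h :: "nat \<Rightarrow> real"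
      by (rule sum.reindex_bij_witness[where i = Suc and j = "\<lambda>j. j - 1"]) auto
    have split: "(\<Sum>j=1..r. if j = r then f x else Q j) = f x + (\<Sum>j<r. Q j) - Q 0"
    proof -
      obtain m where m: "r = Suc m" using r by (cases r) auto
      have "(\<Sum>j=1..r. if j = r then f x else Q j) = (\<Sum>j<m. Q (Suc j)) + f x"
        unfolding sh unfolding m sum.lessThan_Suc by (intro arg_cong2[where f = "(+)"] sum.cong) auto
      moreover have "(\<Sum>j<r. Q j) = Q 0 + (\<Sum>j<m. Q (Suc j))"
        unfolding m by (rule sum.lessThan_Suc_shift)
      ultimately show ?thesis by simp
    qed
    have "f x - (\<Sum>j<r. P (Suc j) - Q j) \<le> b + \<delta>"
      using y[OF xK] unfolding ysum sh Ej .
    then show ?thesis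
      unfolding Dj sum_subtractf split Q0[symmetric] sh[of P] by simp
  qed
  then show ?thesis by blast
qed

text \<open>Truncating the strategies to entries of size at most \<open>B\<close> costs a slack \<open>\<eta>\<close> in the dual
  constraints. It is absorbed by adding \<open>\<eta> * D ^ (r - j)\<close> times the identity to the multipliers; for
  \<open>B = D ^ r\<close> this increases the dual objective by no more than the truncation had saved.\<close>

theorem strong_duality:
  assumes r: "r \<ge> 1" and M: "psd d (after r) M" and \<delta>: "\<delta> > 0"
    and bd: "\<And>X. chain r d X \<Longrightarrow> Re (hs_inner d (after r) M (X r)) \<le> b"
  shows "\<exists>R. dual_chain r d M R \<and> Re (tr d (Xs 1) (R 1)) \<le> b + \<delta>"
proof -
  define m where "m j = real (card (cfgs d {RX j}))" for j
  \<comment> \<open>Exceeds the dimension of every \<open>RX j\<close> by at least 1, which drives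
    the geometric correction \<open>e\<close> below.\<close>
  define D where "D = 1 + (\<Sum>j=1..r. m j)"
  have mD: "1 + m j \<le> D" if "j \<in> {1..r}" for j
    unfolding D_def using member_le_sum[of j "{1..r}" m] that by (auto simp: m_def)
  have D1: "D \<ge> 1" unfolding D_def by (simp add: m_def sum_nonneg)
  define B where "B = D ^ r"
  have B: "B \<ge> 1" unfolding B_def using D1 by simp
  obtain R where R: "\<And>X. X 0 = (\<lambda>_ _. 1) \<Longrightarrow> (\<And>j a c. cmod (X j a c) \<le> B) \<Longrightarrow> (\<And>j. j \<in> {1..r} \<Longrightarrow> psd d (after j) (X j)) \<Longrightarrow>
     Re (tr d (Xs 1) (R 1)) - (\<Sum>j=1..r. Re (hs_inner d (after j)
        (\<lambda>a c. ext_id j (R j) a c - (if j = r then M else ptrace d {RX (Suc j)} (R (Suc j))) a c) (X j))) \<le> b + \<delta>"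
    using approximate_multipliers[OF r \<delta> B, of d M b] bd by blast
  define N where "N j = (if j = r then M else ptrace d {RX (Suc j)} (R (Suc j)))" for j
  define \<Delta> where "\<Delta> j a c = ext_id j (R j) a c - N j a c" for j a c
  define \<tau> where "\<tau> = Re (tr d (Xs 1) (R 1))"
  \<comment> \<open>The gap between the bound and the trace term, divided by the size
    \<open>B\<close> of the largest test operator.\<close>
  define \<eta> where "\<eta> = (b + \<delta> - \<tau>) / B"
  have lag: "\<tau> - (\<Sum>j=1..r. Re (hs_inner d (after j) (\<Delta> j) (X j))) \<le> b + \<delta>"
    if "X 0 = (\<lambda>_ _. 1)" "\<And>j a c. cmod (X j a c) \<le> B" "\<And>j. j \<in> {1..r} \<Longrightarrow> psd d (after j) (X j)" for X
    using R[OF that] unfolding \<tau>_def \<Delta>_def N_def .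
  have "\<tau> \<le> b + \<delta>"
  proof -
    have "hs_inner d S A (\<lambda>_ _. 0) = 0" for S A by (simp add: hs_inner_def)
    then show ?thesis
      using lag[of "\<lambda>j _ _. if j = 0 then 1 else 0"] B by (simp add: psd_zero)
  qed
  then have \<eta>: "\<eta> \<ge> 0" using B by (simp add: \<eta>_def)
  have slack: "Re (hs_inner d (after i) (\<Delta> i) (\<lambda>a b. v a * cnj (v b))) \<ge> - \<eta> * (\<Sum>a\<in>cfgs d (after i). (cmod (v a))\<^sup>2)"
    if i: "i \<in> {1..r}" for i v
  proof -
    define s where "s = (\<Sum>a\<in>cfgs d (after i). (cmod (v a))\<^sup>2)"
    show ?thesis
    proof (cases "s = 0")
      case True
      then have "v a = 0" if "a \<in> cfgs d (after i)" for a
        using that by (simp add: s_def sum_nonneg_eq_0_iff)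
      then show ?thesis using True by (simp add: hs_inner_def s_def)
    next
      case False
      moreover have "s \<ge> 0" unfolding s_def by (intro sum_nonneg) simp
      ultimately have s: "s > 0" by simp
      \<comment> \<open>The truncation bounds entries at all arguments, so \<open>v\<close> is cut
        to 0 outside the configurations.\<close>
      define u where "u a = (if a \<in> cfgs d (after i) then v a else 0)" for a
      have us: "cmod (u a) * cmod (u c) \<le> s" for a c
      proof -
        have sq: "(cmod (u a))\<^sup>2 \<le> s" for a
          unfolding s_def u_def by (cases "a \<in> cfgs d (after i)") (auto intro: member_le_sum sum_nonneg)
        have "2 * (cmod (u a) * cmod (u c)) \<le> (cmod (u a))\<^sup>2 + (cmod (u c))\<^sup>2"
          using sum_squares_bound[of "cmod (u a)" "cmod (u c)"] by (simp add: mult.assoc)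
        then show ?thesis using sq[of a] sq[of c] by linarith
      qed
      \<comment> \<open>Since the Lagrangian has dropped the equality constraints, a test point may
        live in round \<open>i\<close> alone. The factor \<open>B / s\<close> makes it as large as
        the truncation allows.\<close>
      define X where "X j a c = (if j = 0 then 1 else if j = i then of_real (B / s) * (u a * cnj (u c)) else 0)" for j a c
      have "\<tau> - (\<Sum>j=1..r. Re (hs_inner d (after j) (\<Delta> j) (X j))) \<le> b + \<delta>"
      proof (rule lag)
        show "X 0 = (\<lambda>_ _. 1)" by (simp add: X_def fun_eq_iff)
        show "cmod (X j a c) \<le> B" for j a c
        proof -
          have "B / s * (cmod (u a) * cmod (u c)) \<le> B / s * s"
            using us B s by (intro mult_left_mono) auto
          then show ?thesis using B s by (simp add: X_def norm_mult norm_divide)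
        qed
        show "psd d (after j) (X j)" if "j \<in> {1..r}" for j
        proof (cases "j = i")
          case True
          have "X j = (\<lambda>a c. of_real (B / s) * (u a * cnj (u c)))"
            using True that by (simp add: X_def fun_eq_iff)
          then show ?thesis using B s by (simp only:) (intro psd_scale psd_rank_one, simp)
        next
          case False
          then have "X j = (\<lambda>_ _. 0)" using that by (simp add: X_def fun_eq_iff)
          then show ?thesis by (simp add: psd_zero)
        qed
      qed
      moreover have "(\<Sum>j=1..r. Re (hs_inner d (after j) (\<Delta> j) (X j))) = Re (hs_inner d (after i) (\<Delta> i) (X i))"
      proof -
        have "hs_inner d (after j) (\<Delta> j) (X j) = 0" if "j \<in> {1..r} - {i}" for j
          using that by (simp add: hs_inner_def X_def)
        then show ?thesis by (subst sum.remove[OF _ i]) auto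
      qed
      moreover have "hs_inner d (after i) (\<Delta> i) (X i) = of_real (B / s) * hs_inner d (after i) (\<Delta> i) (\<lambda>a b. v a * cnj (v b))"
      proof -
        have "hs_inner d (after i) (\<Delta> i) (X i) = hs_inner d (after i) (\<Delta> i) (\<lambda>a c. of_real (B / s) * (v a * cnj (v c)))"
          using i by (intro hs_inner_cong) (auto simp: op_eq_def X_def u_def)
        then show ?thesis by (simp only: hs_inner_scale_right)
      qed
      ultimately have "\<tau> - (B / s) * Re (hs_inner d (after i) (\<Delta> i) (\<lambda>a b. v a * cnj (v b))) \<le> b + \<delta>"
        by (simp only: Re_complex_of_real times_complex.sel Im_complex_of_real mult_zero_left diff_zero)
      then show ?thesis unfolding s_def[symmetric] \<eta>_def using s B by (simp add: field_simps)
    qed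
  qed
  \<comment> \<open>Solves \<open>e j - m (Suc j) * e (Suc j) \<ge> \<eta>\<close> backwards from
    \<open>e r = \<eta>\<close>: each step multiplies by \<open>D\<close>, and
    \<open>D - m (Suc j)\<close> is at least 1.\<close>
  define e where "e j = \<eta> * D ^ (r - j)" for j
  define R' where "R' j a c = (R j a c + cnj (R j c a)) / 2 + of_real (e j) * idop a c" for j a c
  define N' where "N' j = (if j = r then M else ptrace d {RX (Suc j)} (R' (Suc j)))" for j
  \<comment> \<open>The net multiple of the identity in round \<open>j\<close>, after the partial
    trace of the next shift has taken its share.\<close>
  define \<kappa> where "\<kappa> j = e j - (if j = r then 0 else m (Suc j) * e (Suc j))" for j
  have \<kappa>: "\<eta> \<le> \<kappa> j" if j: "j \<in> {1..r}" for j
  proof (cases "j = r")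
    case True
    then show ?thesis by (simp add: \<kappa>_def e_def)
  next
    case False
    then have "Suc j \<in> {1..r}" "r - j = Suc (r - Suc j)" using j by auto
    then have "\<kappa> j = \<eta> * (D ^ (r - Suc j) * (D - m (Suc j)))"
      using False by (simp add: \<kappa>_def e_def algebra_simps)
    moreover have "1 * 1 \<le> D ^ (r - Suc j) * (D - m (Suc j))"
      using D1 mD[OF \<open>Suc j \<in> {1..r}\<close>] by (intro mult_mono) auto
    then have "\<eta> * 1 \<le> \<eta> * (D ^ (r - Suc j) * (D - m (Suc j)))"
      using \<eta> by (intro mult_left_mono) auto
    ultimately show ?thesis by simp
  qed
  have key: "psd d (after j) (\<lambda>a c. ext_id j (R' j) a c - N' j a c)" if j: "j \<in> {1..r}" for j
  proof -
    have j1: "j \<ge> 1" using j by simp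
    have "psd d (after j) (\<lambda>a c. (\<Delta> j a c + cnj (\<Delta> j c a)) / 2 + of_real (\<kappa> j) * idop a c)"
      by (rule psd_hermitian_part_shift[OF _ slack[OF j] \<kappa>[OF j]]) simp
    moreover have "op_eq d (after j) (\<lambda>a c. ext_id j (R' j) a c - N' j a c)
        (\<lambda>a c. (\<Delta> j a c + cnj (\<Delta> j c a)) / 2 + of_real (\<kappa> j) * idop a c)"
      unfolding op_eq_def
    proof (intro ballI)
      fix a c assume ac: "a \<in> cfgs d (after j)" "c \<in> cfgs d (after j)"
      have sym: "idop (restrict a T) (restrict c T) = idop (restrict c T) (restrict a T)" for T
        by (auto simp: idop_def)
      have "ext_id j (R' j) a c = (ext_id j (R j) a c + cnj (ext_id j (R j) c a)) / 2 + of_real (e j) * tensor (before j) {RY j} idop idop a c"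
        unfolding tensor_def R'_def by (simp add: sym[of "{RY j}"] field_simps)
      also have "tensor (before j) {RY j} idop idop a c = idop a c"
        by (rule tensor_idop_idop[of _ d]) (use ac after_eq[OF j1] in auto)
      finally have 1: "ext_id j (R' j) a c = (ext_id j (R j) a c + cnj (ext_id j (R j) c a)) / 2 + of_real (e j) * idop a c" .
      have 2: "N' j a c = (N j a c + cnj (N j c a)) / 2 + of_real (e j - \<kappa> j) * idop a c"
      proof (cases "j = r")
        case True
        then show ?thesis using psd_hermitian[OF _ M, of a c] ac by (simp add: N'_def N_def \<kappa>_def)
      next
        case False
        have "ptrace d {RX (Suc j)} (R' (Suc j)) a c
            = (ptrace d {RX (Suc j)} (R (Suc j)) a c + cnj (ptrace d {RX (Suc j)} (R (Suc j)) c a)) / 2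
              + of_real (e (Suc j)) * ptrace d {RX (Suc j)} idop a c"
          unfolding ptrace_def R'_def cnj_sum by (simp add: sum.distrib sum_distrib_left sum_divide_distrib add_divide_distrib)
        also have "ptrace d {RX (Suc j)} idop a c = of_real (m (Suc j)) * idop a c"
          unfolding m_def of_real_of_nat_eq
          by (rule ptrace_idop[of "after j"]) (use after_disjoint[of "Suc j"] ac in auto)
        finally show ?thesis using False by (simp add: N'_def N_def \<kappa>_def)
      qed
      show "ext_id j (R' j) a c - N' j a c = (\<Delta> j a c + cnj (\<Delta> j c a)) / 2 + of_real (\<kappa> j) * idop a c"
        unfolding 1 2 \<Delta>_def by (simp add: field_simps)
    qed
    ultimately show ?thesis using psd_cong by blast
  qed
  have "dual_chain r d M R'"
    unfolding dual_chain_def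
  proof (intro conjI ballI)
    show "psd d (after r) (\<lambda>a c. ext_id r (R' r) a c - M a c)"
      using key[of r] r by (simp add: N'_def)
    show "psd d (after j) (\<lambda>a c. ext_id j (R' j) a c - ptrace d {RX (Suc j)} (R' (Suc j)) a c)" if "j \<in> {1..<r}" for j
      using key[of j] that by (simp add: N'_def)
  qed
  moreover have "Re (tr d (Xs 1) (R' 1)) \<le> b + \<delta>"
  proof -
    have X1: "Xs 1 = {RX 1}" using Xs_insert[of 1] by simp
    have "Re (tr d (Xs 1) (R' 1)) = \<tau> + e 1 * m 1"
      unfolding tr_def R'_def \<tau>_def m_def X1 by (simp add: sum.distrib idop_def)
    also have "e 1 * m 1 \<le> \<eta> * B"
    proof -
      obtain q where q: "r = Suc q" using r by (cases r) auto
      have "\<eta> * D ^ q * m 1 \<le> \<eta> * D ^ q * D"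
        using \<eta> D1 mD[of 1] r by (intro mult_left_mono) auto
      then show ?thesis by (simp add: e_def B_def q mult_ac)
    qed
    also have "\<eta> * B = b + \<delta> - \<tau>" using B by (simp add: \<eta>_def)
    finally show ?thesis by simp
  qed
  ultimately show ?thesis by blast
qed

section \<open>Verifiers\<close>

lemma psd_diff_op_eq: "op_eq d S A B \<Longrightarrow> psd d S (\<lambda>a b. B a b - A a b)"
  by (subst psd_cong[where B = "\<lambda>_ _. 0"]) (simp_all add: op_eq_def psd_zero)

lemma verifier_costrategy:
  assumes "verifier r d P0 P1"
  obtains R where "tr d (Xs 1) (R 1) = 1"
    and "\<And>j. j \<in> {1..<r} \<Longrightarrow> op_eq d (after j) (ptrace d {RX (Suc j)} (R (Suc j))) (ext_id j (R j))"
    and "op_eq d (after r) (op_add P0 P1) (ext_id r (R r))"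
  using assms unfolding verifier_def Defs.density_def tensor_commute[of "{RY _}"] Suc_eq_plus1[symmetric] by blast

lemma verifier_psd:
  assumes "verifier r d P0 P1"
  shows "psd d (after r) (sel P0 P1 x)"
  using assms by (simp add: verifier_def sel_def)

lemma verifier_dual_chain:
  assumes "verifier r d P0 P1"
  obtains R where "dual_chain r d (op_add P0 P1) R" "dual_chain r d P1 R" "tr d (Xs 1) (R 1) = 1"
proof -
  obtain R where R: "tr d (Xs 1) (R 1) = 1"
    "\<And>j. j \<in> {1..<r} \<Longrightarrow> op_eq d (after j) (ptrace d {RX (Suc j)} (R (Suc j))) (ext_id j (R j))"
    "op_eq d (after r) (op_add P0 P1) (ext_id r (R r))"
    by (rule verifier_costrategy[OF assms], rule that)
  have "op_eq d (after r) (\<lambda>a b. ext_id r (R r) a b - P1 a b) P0"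
    using op_eq_sym[OF R(3)] by (simp add: op_eq_def op_add_def)
  then have "psd d (after r) (\<lambda>a b. ext_id r (R r) a b - P1 a b)"
    using verifier_psd[OF assms, of 0] by (simp add: psd_cong sel_def)
  then show ?thesis
    using R by (intro that[of R]) (auto simp: dual_chain_def psd_diff_op_eq)
qed

abbreviation win :: "nat \<Rightarrow> nat \<Rightarrow> (reg \<Rightarrow> nat) \<Rightarrow> reg op \<Rightarrow> reg op \<Rightarrow> (nat \<times> reg) op \<Rightarrow> (nat \<Rightarrow> nat) \<Rightarrow> real" where
  "win n r d P0 P1 X i \<equiv> Re (hs_inner (nd d) ({..<n} \<times> after r) (prod_op n (after r) (sel P0 P1) i) X)"

lemma p_opt_eq: "p_opt r d P0 P1 = Sup {win 1 r d P0 P1 X (\<lambda>_. 1) | X. strategy 1 r d X}"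
  by (simp only: p_opt_def copies_after)

lemma p_rep_eq: "p_rep n k r d P0 P1 = Sup {\<Sum>i\<in>Sigma_ge n k. win n r d P0 P1 X i | X. strategy n r d X}"
  by (simp only: p_rep_def copies_after Re_sum)

lemma strategy_psd:
  assumes "strategy n r d X" "r \<ge> 1"
  shows "psd (nd d) ({..<n} \<times> after r) X"
  using assms unfolding strategy_def copies_after by auto

lemma win_nonneg:
  assumes "verifier r d P0 P1" "strategy n r d X" "r \<ge> 1"
  shows "win n r d P0 P1 X i \<ge> 0"
proof -
  have "hs_inner (nd d) ({..<n} \<times> after r) (prod_op n (after r) (sel P0 P1) i) X \<in> \<real>\<^sub>\<ge>\<^sub>0"
    unfolding prod_op_eq_tens[where P = "sel P0 P1"]
    by (intro hs_inner_psd psd_tens strategy_psd[OF assms(2,3)] verifier_psd[OF assms(1)]) auto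
  then show ?thesis by (simp add: complex_nonneg_Reals_iff)
qed

text \<open>Summing over a box of outcome strings gives a product operator again: \<open>Z m\<close>
  lists the outcomes allowed in copy \<open>m\<close>.\<close>

lemma sum_win:
  assumes "\<And>m. m < n \<Longrightarrow> finite (Z m)"
  shows "(\<Sum>i\<in>PiE {..<n} Z. win n r d P0 P1 X i)
     = Re (hs_inner (nd d) ({..<n} \<times> after r) (tens n (after r) (\<lambda>m a b. \<Sum>x\<in>Z m. sel P0 P1 x a b)) X)"
proof -
  have "tens n (after r) (\<lambda>m a b. \<Sum>x\<in>Z m. sel P0 P1 x a b)
      = (\<lambda>a b. \<Sum>i\<in>PiE {..<n} Z. tens n (after r) (\<lambda>k. sel P0 P1 (i k)) a b)"
    by (rule tens_sum) (rule assms)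
  then show ?thesis
    by (simp only: hs_inner_sum_left Re_sum prod_op_eq_tens[where P = "sel P0 P1"])
qed

text \<open>For the verifier's own co-strategy the constraints are equalities, so the unrolling is
  exact and ends at trace 1.\<close>

lemma sum_win_all:
  assumes "verifier r d P0 P1" "strategy n r d X" "r \<ge> 1"
  shows "(\<Sum>i\<in>PiE {..<n} (\<lambda>_. {0, 1}). win n r d P0 P1 X i) = 1"
proof -
  obtain R where R: "tr d (Xs 1) (R 1) = 1"
    "\<And>j. j \<in> {1..<r} \<Longrightarrow> op_eq d (after j) (ptrace d {RX (Suc j)} (R (Suc j))) (ext_id j (R j))"
    "op_eq d (after r) (op_add P0 P1) (ext_id r (R r))"
    by (rule verifier_costrategy[OF assms(1)], rule that)
  obtain Xj where Xj: "Xj r = X"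
    and one: "\<And>R. hs_inner (nd d) ({..<n} \<times> after 1) (tens n (after 1) (\<lambda>k. ext_id 1 (R k))) (Xj 1)
          = (\<Prod>k<n. cnj (tr d (Xs 1) (R k)))"
    and unroll: "\<And>j R. j \<in> {1..<r} \<Longrightarrow>
        hs_inner (nd d) ({..<n} \<times> after (Suc j)) (tens n (after (Suc j)) (\<lambda>k. ext_id (Suc j) (R k))) (Xj (Suc j))
          = hs_inner (nd d) ({..<n} \<times> after j) (tens n (after j) (\<lambda>k. ptrace d {RX (Suc j)} (R k))) (Xj j)"
    by (rule strategy_unroll[OF assms(2,3)], rule that)
  have "hs_inner (nd d) ({..<n} \<times> after r) (tens n (after r) (\<lambda>_. ext_id r (R r))) (Xj r) = 1"
    using assms(3)
  proof (induction r rule: dec_induct)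
    case base
    show ?case unfolding one R(1) by simp
  next
    case (step j)
    then have j: "j \<in> {1..<r}" by auto
    have "hs_inner (nd d) ({..<n} \<times> after (Suc j)) (tens n (after (Suc j)) (\<lambda>_. ext_id (Suc j) (R (Suc j)))) (Xj (Suc j))
        = hs_inner (nd d) ({..<n} \<times> after j) (tens n (after j) (\<lambda>_. ext_id j (R j))) (Xj j)"
      unfolding unroll[OF j] by (intro hs_inner_cong tens_cong op_eq_refl R(2)[OF j])
    then show ?case using step.IH by simp
  qed
  moreover have "hs_inner (nd d) ({..<n} \<times> after r) (tens n (after r) (\<lambda>_ a b. \<Sum>x\<in>{0, 1}. sel P0 P1 x a b)) X
      = hs_inner (nd d) ({..<n} \<times> after r) (tens n (after r) (\<lambda>_. ext_id r (R r))) (Xj r)"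
    unfolding Xj using R(3) by (intro hs_inner_cong tens_cong op_eq_refl) (simp add: op_eq_def op_add_def sel_def)
  ultimately show ?thesis by (subst sum_win) auto
qed

lemma Sigma_ge_subset: "Sigma_ge n k \<subseteq> PiE {..<n} (\<lambda>_. {0, 1})"
  by (auto simp: Sigma_ge_def)

lemma finite_bits: "finite (PiE {..<n::nat} (\<lambda>_. {0, 1::nat}))"
  by (intro finite_PiE) auto

lemma sum_win_Sigma_ge_le_one:
  assumes "verifier r d P0 P1" "strategy n r d X" "r \<ge> 1"
  shows "(\<Sum>i\<in>Sigma_ge n k. win n r d P0 P1 X i) \<le> 1"
  unfolding sum_win_all[OF assms, symmetric]
  by (intro sum_mono2 finite_bits Sigma_ge_subset win_nonneg[OF assms])

text \<open>Union bound over the \<open>k\<close>-element sets of copies that are all accepted.\<close>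

lemma sum_win_Sigma_ge_le:
  assumes V: "verifier r d P0 P1" and st: "strategy n r d X" and r: "r \<ge> 1" and d: "\<And>l. d l > 0"
    and R: "dual_chain r d P1 R"
  shows "(\<Sum>i\<in>Sigma_ge n k. win n r d P0 P1 X i) \<le> real (n choose k) * Re (tr d (Xs 1) (R 1)) ^ k"
proof -
  define t where "t = Re (tr d (Xs 1) (R 1))"
  \<comment> \<open>Copies in \<open>T\<close> must accept; the others are free, which puts
    \<open>P0 + P1\<close> in their factor.\<close>
  define Z where "Z T m = (if m \<in> T then {1} else {0, 1::nat})" for T and m :: nat
  define \<T> where "\<T> = {T. T \<subseteq> {..<n} \<and> card T = k}"
  have fin: "finite \<T>" unfolding \<T>_def by simp
  have finZ: "finite (Z T m)" for T m by (simp add: Z_def)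
  obtain Rv where Rv: "dual_chain r d (op_add P0 P1) Rv" "tr d (Xs 1) (Rv 1) = 1"
    by (rule verifier_dual_chain[OF V], rule that)
  have one: "(\<Sum>i\<in>PiE {..<n} (Z T). win n r d P0 P1 X i) \<le> t ^ k" if T: "T \<in> \<T>" for T
  proof -
    have "(\<lambda>m a b. \<Sum>x\<in>Z T m. sel P0 P1 x a b) = (\<lambda>m. if m \<in> T then P1 else op_add P0 P1)"
      by (auto simp: Z_def sel_def op_add_def fun_eq_iff)
    then have "(\<Sum>i\<in>PiE {..<n} (Z T). win n r d P0 P1 X i)
       = Re (hs_inner (nd d) ({..<n} \<times> after r) (tens n (after r) (\<lambda>m. if m \<in> T then P1 else op_add P0 P1)) X)"
      by (simp add: sum_win[OF finZ])
    also have "\<dots> \<le> (\<Prod>m<n. Re (tr d (Xs 1) ((if m \<in> T then R else Rv) 1)))"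
    proof (rule weak_duality[OF st r d])
      have "psd d (after r) (\<lambda>a b. P0 a b + P1 a b)"
        using verifier_psd[OF V, of 0] verifier_psd[OF V, of 1] by (intro psd_add) (simp_all add: sel_def)
      then show "psd d (after r) (if m \<in> T then P1 else op_add P0 P1)" for m
        using verifier_psd[OF V, of 1] by (simp add: sel_def op_add_def[abs_def])
      show "dual_chain r d (if m \<in> T then P1 else op_add P0 P1) (if m \<in> T then R else Rv)" for m
        using R Rv by simp
    qed
    also have "\<dots> = (\<Prod>m<n. if m \<in> T then t else 1)"
      using Rv(2) by (intro prod.cong refl) (simp add: t_def)
    also have "\<dots> = t ^ k"
    proof -
      have "{..<n} \<inter> T = T" "card T = k" using T by (auto simp: \<T>_def)
      then show ?thesis by (simp add: prod.If_cases)
    qed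
    finally show ?thesis .
  qed
  have "(\<Sum>i\<in>Sigma_ge n k. win n r d P0 P1 X i)
      \<le> (\<Sum>(T, i)\<in>(SIGMA T:\<T>. PiE {..<n} (Z T)). win n r d P0 P1 X i)"
  proof (rule sum_le_included[where i = snd])
    show "finite (Sigma_ge n k)" using finite_subset[OF Sigma_ge_subset finite_bits] .
    show "finite (SIGMA T:\<T>. PiE {..<n} (Z T))" by (intro finite_SigmaI fin finite_PiE finZ) simp
    show "\<forall>y\<in>(SIGMA T:\<T>. PiE {..<n} (Z T)). 0 \<le> (case y of (T, i) \<Rightarrow> win n r d P0 P1 X i)"
      using win_nonneg[OF V st r] by auto
    show "\<forall>i\<in>Sigma_ge n k. \<exists>y\<in>(SIGMA T:\<T>. PiE {..<n} (Z T)). snd y = i \<and>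
        win n r d P0 P1 X i \<le> (case y of (T, i) \<Rightarrow> win n r d P0 P1 X i)"
    proof
      fix i assume i: "i \<in> Sigma_ge n k"
      then obtain T where T: "T \<subseteq> {m \<in> {..<n}. i m = 1}" "card T = k"
        by (metis (mono_tags, lifting) Sigma_ge_def mem_Collect_eq obtain_subset_with_card_n)
      then have "T \<in> \<T>" "i \<in> PiE {..<n} (Z T)" using i by (auto simp: \<T>_def Z_def Sigma_ge_def PiE_iff)
      then show "\<exists>y\<in>(SIGMA T:\<T>. PiE {..<n} (Z T)). snd y = i \<and>
        win n r d P0 P1 X i \<le> (case y of (T, i) \<Rightarrow> win n r d P0 P1 X i)"
        by (intro bexI[of _ "(T, i)"]) auto
    qed
  qed
  also have "\<dots> = (\<Sum>T\<in>\<T>. \<Sum>i\<in>PiE {..<n} (Z T). win n r d P0 P1 X i)"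
    by (rule sum.Sigma[symmetric]) (auto intro: fin finite_PiE finZ)
  also have "\<dots> \<le> (\<Sum>T\<in>\<T>. t ^ k)" by (intro sum_mono one)
  also have "\<dots> = real (n choose k) * t ^ k" by (simp add: \<T>_def n_subsets)
  finally show ?thesis by (simp add: t_def)
qed

text \<open>Under independent play the probabilities multiply; the factors are nonnegative reals, so
  \<open>Re\<close> passes through the product.\<close>

lemma win_product_strategy:
  assumes V: "verifier r d P0 P1" and X: "chain r d X" and r: "r \<ge> 1"
  shows "win n r d P0 P1 (tens n (after r) (\<lambda>_. X r)) i
     = (\<Prod>m<n. Re (hs_inner d (after r) (sel P0 P1 (i m)) (X r)))"
proof -
  have "hs_inner d (after r) (sel P0 P1 x) (X r) \<in> \<real>\<^sub>\<ge>\<^sub>0" for x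
    using X r by (intro hs_inner_psd verifier_psd[OF V]) (auto simp: chain_def)
  then have re: "hs_inner d (after r) (sel P0 P1 x) (X r) = of_real (Re (hs_inner d (after r) (sel P0 P1 x) (X r)))" for x
    by (simp add: complex_nonneg_Reals_iff complex_eq_iff)
  have "hs_inner (nd d) ({..<n} \<times> after r) (prod_op n (after r) (sel P0 P1) i) (tens n (after r) (\<lambda>_. X r))
      = (\<Prod>m<n. hs_inner d (after r) (sel P0 P1 (i m)) (X r))"
    unfolding prod_op_eq_tens[of n _ "sel P0 P1"] by (rule hs_inner_tens) simp
  also have "\<dots> = of_real (\<Prod>m<n. Re (hs_inner d (after r) (sel P0 P1 (i m)) (X r)))"
    unfolding of_real_prod using re by (intro prod.cong refl) blast
  finally show ?thesis by (simp only: Re_complex_of_real)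
qed

section \<open>Values of the single game and of its parallel repetition\<close>

text \<open>Without a strategy every bound holds vacuously, even -2; duality with \<delta> = 1 would
  then give a positive operator of negative trace.\<close>

lemma chain_exists:
  assumes V: "verifier r d P0 P1" and r: "r \<ge> 1" and d: "\<And>l. d l > 0"
  shows "\<exists>X. chain r d X"
proof (rule ccontr)
  assume none: "\<nexists>X. chain r d X"
  have P1: "psd d (after r) P1" using verifier_psd[OF V, of 1] by (simp add: sel_def)
  have "\<exists>R. dual_chain r d P1 R \<and> Re (tr d (Xs 1) (R 1)) \<le> - 2 + 1"
    by (rule strong_duality[OF r P1]) (use none in auto)
  then obtain R where R: "dual_chain r d P1 R" "Re (tr d (Xs 1) (R 1)) < 0" by auto
  then have "psd d (before 1) (R 1)" using r by (intro dual_chain_psd[OF R(1) P1 d]) auto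
  then have "tr d (Xs 1) (R 1) \<in> \<real>\<^sub>\<ge>\<^sub>0" by (intro tr_psd) auto
  then show False using R by (simp add: complex_nonneg_Reals_iff)
qed

lemma win_le_trace:
  assumes V: "verifier r d P0 P1" and st: "strategy 1 r d X" and r: "r \<ge> 1" and d: "\<And>l. d l > 0"
    and R: "dual_chain r d P1 R"
  shows "win 1 r d P0 P1 X (\<lambda>_. 1) \<le> Re (tr d (Xs 1) (R 1))"
  using weak_duality[OF st r d, of "\<lambda>_. P1" "\<lambda>_. R"] R verifier_psd[OF V, of 1]
  by (simp add: prod_op_eq_tens[of _ _ "sel P0 P1"] sel_def)

lemma p_opt_le:
  assumes "verifier r d P0 P1" "r \<ge> 1" "\<And>l. d l > 0" "dual_chain r d P1 R"
  shows "p_opt r d P0 P1 \<le> Re (tr d (Xs 1) (R 1))"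
  unfolding p_opt_eq
proof (rule cSup_least)
  obtain X where "chain r d X" using chain_exists[OF assms(1-3)] by blast
  then show "{win 1 r d P0 P1 X (\<lambda>_. 1) | X. strategy 1 r d X} \<noteq> {}"
    using chain_imp_strategy[OF _ assms(2)] by blast
qed (use win_le_trace[OF assms(1) _ assms(2-4)] in auto)

text \<open>The supremum is bounded above by the trace of the verifier's own co-strategy, so each
  chain lies below it.\<close>

lemma chain_le_p_opt:
  assumes V: "verifier r d P0 P1" and r: "r \<ge> 1" and d: "\<And>l. d l > 0" and X: "chain r d X"
  shows "Re (hs_inner d (after r) P1 (X r)) \<le> p_opt r d P0 P1"
proof -
  obtain R where R: "dual_chain r d P1 R" by (rule verifier_dual_chain[OF V])
  have "win 1 r d P0 P1 (tens 1 (after r) (\<lambda>_. X r)) (\<lambda>_. 1) \<le> p_opt r d P0 P1"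
    unfolding p_opt_eq
  proof (rule cSup_upper)
    show "bdd_above {win 1 r d P0 P1 X (\<lambda>_. 1) | X. strategy 1 r d X}"
      using win_le_trace[OF V _ r d R] by (intro bdd_aboveI[of _ "Re (tr d (Xs 1) (R 1))"]) auto
  qed (use chain_imp_strategy[OF X r] in auto)
  then show ?thesis unfolding win_product_strategy[OF V X r] by (simp add: sel_def)
qed

text \<open>A near-optimal 1-fold strategy is not relabelled. If all chains stayed below
  \<open>q\<close>, a dual chain of trace at most \<open>q + \<delta>\<close> would bound every
  1-fold strategy, and half the gap keeps this below \<open>p_opt\<close>.\<close>

lemma p_opt_near_optimal_chain:
  assumes V: "verifier r d P0 P1" and r: "r \<ge> 1" and d: "\<And>l. d l > 0" and q: "q < p_opt r d P0 P1"
  shows "\<exists>X. chain r d X \<and> q \<le> Re (hs_inner d (after r) P1 (X r))"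
proof (rule ccontr)
  assume none: "\<not> ?thesis"
  define \<delta> where "\<delta> = (p_opt r d P0 P1 - q) / 2"
  have \<delta>: "\<delta> > 0" using q by (simp add: \<delta>_def)
  have P1: "psd d (after r) P1" using verifier_psd[OF V, of 1] by (simp add: sel_def)
  have "\<exists>R. dual_chain r d P1 R \<and> Re (tr d (Xs 1) (R 1)) \<le> q + \<delta>"
    by (rule strong_duality[OF r P1 \<delta>]) (use none in force)
  then have "p_opt r d P0 P1 \<le> q + \<delta>" using p_opt_le[OF V r d] by force
  then show False using q by (simp add: \<delta>_def field_simps)
qed

text \<open>The slack is the whole gap \<open>q - p_opt r d P0 P1\<close>. Nonnegativity of the
  trace is recorded because the union bound raises it to a power.\<close>

lemma p_opt_dual:
  assumes V: "verifier r d P0 P1" and r: "r \<ge> 1" and d: "\<And>l. d l > 0" and q: "p_opt r d P0 P1 < q"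
  shows "\<exists>R. dual_chain r d P1 R \<and> 0 \<le> Re (tr d (Xs 1) (R 1)) \<and> Re (tr d (Xs 1) (R 1)) \<le> q"
proof -
  have P1: "psd d (after r) P1" using verifier_psd[OF V, of 1] by (simp add: sel_def)
  have "\<exists>R. dual_chain r d P1 R \<and> Re (tr d (Xs 1) (R 1)) \<le> p_opt r d P0 P1 + (q - p_opt r d P0 P1)"
    by (rule strong_duality[OF r P1]) (use chain_le_p_opt[OF V r d] q in auto)
  then obtain R where R: "dual_chain r d P1 R" "Re (tr d (Xs 1) (R 1)) \<le> q" by auto
  then have "psd d (before 1) (R 1)" using r by (intro dual_chain_psd[OF R(1) P1 d]) auto
  then have "tr d (Xs 1) (R 1) \<in> \<real>\<^sub>\<ge>\<^sub>0" by (intro tr_psd) auto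
  then show ?thesis using R by (auto simp: complex_nonneg_Reals_iff)
qed

lemma p_rep_le:
  assumes V: "verifier r d P0 P1" and r: "r \<ge> 1" and d: "\<And>l. d l > 0" and q: "p_opt r d P0 P1 < q"
  shows "p_rep n k r d P0 P1 \<le> real (n choose k) * q ^ k"
proof -
  obtain R where R: "dual_chain r d P1 R" "0 \<le> Re (tr d (Xs 1) (R 1))" "Re (tr d (Xs 1) (R 1)) \<le> q"
    using p_opt_dual[OF assms] by blast
  have "real (n choose k) * Re (tr d (Xs 1) (R 1)) ^ k \<le> real (n choose k) * q ^ k"
    using R by (intro mult_left_mono power_mono) auto
  then have "(\<Sum>i\<in>Sigma_ge n k. win n r d P0 P1 X i) \<le> real (n choose k) * q ^ k" if "strategy n r d X" for X
    using sum_win_Sigma_ge_le[OF V that r d R(1), of k] by linarith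
  moreover obtain X where "chain r d X" using chain_exists[OF V r d] by blast
  then have "strategy n r d (tens n (after r) (\<lambda>_. X r))" by (rule chain_imp_strategy[OF _ r])
  ultimately show ?thesis unfolding p_rep_eq by (intro cSup_least) auto
qed

text \<open>Every copy is played independently; the bound is Chernoff's, with \<open>t\<close> weighting each accepted copy.\<close>

lemma p_rep_ge:
  assumes V: "verifier r d P0 P1" and r: "r \<ge> 1" and d: "\<And>l. d l > 0" and q: "q < p_opt r d P0 P1"
    and t: "0 < t" "t \<le> 1"
  shows "p_rep n k r d P0 P1 \<ge> 1 - (1 - q * (1 - t)) ^ n / t ^ k"
proof -
  obtain X where X: "chain r d X" and qX: "q \<le> Re (hs_inner d (after r) P1 (X r))"
    using p_opt_near_optimal_chain[OF V r d q] by blast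
  define w where "w x = Re (hs_inner d (after r) (sel P0 P1 x) (X r))" for x
  note st = chain_imp_strategy[OF X r]
  let ?I = "PiE {..<n} (\<lambda>_. {0, 1::nat})"
  have w0: "w x \<ge> 0" for x
    using win_nonneg[OF V st[of 1] r, of "\<lambda>_. x"] unfolding win_product_strategy[OF V X r] by (simp add: w_def)
  \<comment> \<open>Normalisation of probabilities for a single copy.\<close>
  have w1: "w 0 + w 1 = 1"
  proof -
    have "(\<Sum>i\<in>PiE {..<1::nat} (\<lambda>_. {0, 1::nat}). \<Prod>m<1. w (i m)) = 1"
      using sum_win_all[OF V st[of 1] r] unfolding win_product_strategy[OF V X r] w_def .
    moreover have "(\<Prod>m<1::nat. \<Sum>x\<in>{0, 1}. w x) = (\<Sum>i\<in>PiE {..<1::nat} (\<lambda>_. {0, 1::nat}). \<Prod>m<1. w (i m))"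
      by (rule prod_sum_PiE) auto
    ultimately show ?thesis by simp
  qed
  have tot: "(\<Sum>i\<in>?I. \<Prod>m<n. w (i m)) = 1"
    using sum_win_all[OF V st[of n] r] unfolding win_product_strategy[OF V X r] w_def .
  have "(\<Sum>i\<in>?I - Sigma_ge n k. \<Prod>m<n. w (i m)) \<le> (\<Sum>i\<in>?I - Sigma_ge n k. (\<Prod>m<n. w (i m) * t ^ i m) / t ^ k)"
  proof (rule sum_mono)
    fix i assume i: "i \<in> ?I - Sigma_ge n k"
    let ?c = "card {m \<in> {..<n}. i m = 1}"
    have "(\<Prod>m<n. t ^ i m) = (\<Prod>m<n. if i m = 1 then t else 1)"
      using i by (intro prod.cong refl) (force simp: PiE_iff)
    also have "\<dots> = t ^ ?c"
      by (simp add: prod.If_cases Int_def)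
    finally have c: "(\<Prod>m<n. t ^ i m) = t ^ ?c" .
    \<comment> \<open>A rejected string has fewer than \<open>k\<close> ones, so its weight
      \<open>t ^ ?c\<close> is at least \<open>t ^ k\<close>: Markov's inequality for the weighted
      sum.\<close>
    have "\<not> k \<le> ?c" using i unfolding Sigma_ge_def by blast
    then have "?c \<le> k" by linarith
    then have "t ^ k \<le> t ^ ?c" using t by (intro power_decreasing) auto
    then have "(\<Prod>m<n. w (i m)) * t ^ k \<le> (\<Prod>m<n. w (i m)) * t ^ ?c"
      using w0 by (intro mult_left_mono prod_nonneg) auto
    then show "(\<Prod>m<n. w (i m)) \<le> (\<Prod>m<n. w (i m) * t ^ i m) / t ^ k"
      using t by (simp add: prod.distrib c pos_le_divide_eq)
  qed
  also have "\<dots> \<le> (\<Sum>i\<in>?I. (\<Prod>m<n. w (i m) * t ^ i m) / t ^ k)"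
    using t w0 by (intro sum_mono2 finite_bits) (auto intro!: divide_nonneg_pos prod_nonneg mult_nonneg_nonneg)
  also have "\<dots> = (\<Prod>m<n. \<Sum>x\<in>{0, 1}. w x * t ^ x) / t ^ k"
    unfolding sum_divide_distrib[symmetric] by (subst prod_sum_PiE) auto
  also have "\<dots> = (1 - w 1 * (1 - t)) ^ n / t ^ k"
  proof -
    have "(\<Sum>x\<in>{0, 1}. w x * t ^ x) = 1 - w 1 * (1 - t)"
      using w1 by (simp add: algebra_simps)
    then show ?thesis by (simp only: prod_constant card_lessThan)
  qed
  also have "\<dots> \<le> (1 - q * (1 - t)) ^ n / t ^ k"
  proof -
    have "q * (1 - t) \<le> w 1 * (1 - t)" using qX t by (intro mult_right_mono) (auto simp: w_def sel_def)
    \<comment> \<open>Keeps the smaller base nonnegative, as monotonicity of powers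
      requires.\<close>
    moreover have "w 1 * (1 - t) \<le> 1 * 1" using w1 w0[of 0] w0[of 1] t by (intro mult_mono) auto
    ultimately show ?thesis using t by (intro divide_right_mono power_mono) auto
  qed
  finally have "(\<Sum>i\<in>?I - Sigma_ge n k. \<Prod>m<n. w (i m)) \<le> (1 - q * (1 - t)) ^ n / t ^ k" .
  moreover have "(\<Sum>i\<in>?I - Sigma_ge n k. \<Prod>m<n. w (i m)) = 1 - (\<Sum>i\<in>Sigma_ge n k. \<Prod>m<n. w (i m))"
    by (simp only: sum_diff[OF finite_bits Sigma_ge_subset] tot)
  moreover have "(\<Sum>i\<in>Sigma_ge n k. \<Prod>m<n. w (i m)) \<le> p_rep n k r d P0 P1"
    unfolding p_rep_eq
  proof (rule cSup_upper)
    show "(\<Sum>i\<in>Sigma_ge n k. \<Prod>m<n. w (i m)) \<in> {\<Sum>i\<in>Sigma_ge n k. win n r d P0 P1 X i |X. strategy n r d X}"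
      unfolding w_def using win_product_strategy[OF V X r, of n] st[of n] by (auto intro!: exI[of _ "tens n (after r) (\<lambda>_. X r)"])
    show "bdd_above {\<Sum>i\<in>Sigma_ge n k. win n r d P0 P1 X i |X. strategy n r d X}"
      using sum_win_Sigma_ge_le_one[OF V _ r] by (intro bdd_aboveI[of _ 1]) auto
  qed
  ultimately show ?thesis by linarith
qed

section \<open>Choice of the constants\<close>

lemma exponential_decay_constant:
  fixes A \<gamma> :: real
  assumes "A > 0" "0 < \<gamma>" "\<gamma> < 1"
  shows "\<exists>C>0. \<forall>\<epsilon> n. 0 < \<epsilon> \<longrightarrow> \<epsilon> \<le> 1/2 \<longrightarrow> real n \<ge> C * ln (1/\<epsilon>) \<longrightarrow> A * \<gamma> ^ n \<le> \<epsilon>"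
proof -
  define l where "l = - ln \<gamma>"
  have l: "l > 0" using assms by (simp add: l_def)
  \<comment> \<open>As \<epsilon> is at most 1/2, \<open>ln (1/\<epsilon>)\<close> is at least
    \<open>ln 2\<close>, so the prefactor \<open>A\<close> costs only a multiple of it.\<close>
  define C where "C = (1 + \<bar>ln A\<bar> / ln 2) / l"
  have C: "C > 0" using l by (auto simp: C_def intro!: divide_pos_pos add_pos_nonneg)
  have "A * \<gamma> ^ n \<le> \<epsilon>" if \<epsilon>: "0 < \<epsilon>" "\<epsilon> \<le> 1/2" and n: "real n \<ge> C * ln (1/\<epsilon>)" for \<epsilon> and n :: nat
  proof -
    define L where "L = ln (1/\<epsilon>)"
    have "2 \<le> 1/\<epsilon>" using \<epsilon> by (simp add: field_simps)
    then have L: "ln 2 \<le> L" unfolding L_def using \<epsilon> by (intro ln_mono) auto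
    have "\<bar>ln A\<bar> = \<bar>ln A\<bar> / ln 2 * ln 2" by simp
    also have "\<dots> \<le> \<bar>ln A\<bar> / ln 2 * L" using L by (intro mult_left_mono) auto
    finally have "ln A + L \<le> (1 + \<bar>ln A\<bar> / ln 2) * L" by (simp add: algebra_simps)
    also have "\<dots> = C * L * l" using l by (simp add: C_def)
    also have "\<dots> \<le> real n * l" using n l by (intro mult_right_mono) (auto simp: L_def)
    finally have "ln A + real n * ln \<gamma> \<le> ln \<epsilon>"
      using \<epsilon> by (simp add: l_def L_def ln_div)
    then have "ln (A * \<gamma> ^ n) \<le> ln \<epsilon>" using assms by (simp add: ln_mult ln_realpow)
    then show ?thesis using assms \<epsilon> by simp
  qed
  then show ?thesis using C by blast
qed

text \<open>The exponential is 2^(-H(c)/c) in natural logarithms. Continuity at \<alpha> from the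
  left leaves room for both a rational \<open>c\<close> and a strict margin \<open>b\<close> above
  \<beta>.\<close>

lemma threshold_exists:
  fixes \<alpha> \<beta> :: real
  assumes "0 \<le> \<beta>" and "\<beta> < 2 powr (- H \<alpha> / \<alpha>)" and "0 < \<alpha>" "\<alpha> < 1"
  shows "\<exists>c b. c \<in> \<rat> \<and> 0 < c \<and> c < \<alpha> \<and> \<beta> < b \<and> b < exp ((c * ln c + (1 - c) * ln (1 - c)) / c)"
proof -
  define \<psi> :: "real \<Rightarrow> real" where "\<psi> c = exp ((c * ln c + (1 - c) * ln (1 - c)) / c)" for c
  have "2 powr (- H \<alpha> / \<alpha>) = \<psi> \<alpha>"
    using assms(3,4) by (simp add: \<psi>_def powr_def H_def log_def field_simps)
  then obtain b where b: "\<beta> < b" "b < \<psi> \<alpha>" using assms(2) dense by auto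
  have "isCont \<psi> \<alpha>" unfolding \<psi>_def using assms(3,4) by (intro continuous_intros) auto
  then have "(\<psi> \<longlongrightarrow> \<psi> \<alpha>) (at_left \<alpha>)"
    by (simp add: isCont_def filterlim_at_split)
  then have "eventually (\<lambda>c. b < \<psi> c) (at_left \<alpha>)" using b(2) by (rule order_tendstoD)
  then obtain c0 where c0: "c0 < \<alpha>" "\<And>c. c0 < c \<Longrightarrow> c < \<alpha> \<Longrightarrow> b < \<psi> c"
    by (auto simp: eventually_at_left_field)
  obtain c where c: "c \<in> \<rat>" "max c0 0 < c" "c < \<alpha>"
    using Rats_dense_in_real[of "max c0 0" \<alpha>] c0(1) assms(3) by auto
  then show ?thesis using b(1) c0(2)[of c] by (auto simp: \<psi>_def)
qed

text \<open>A single term of (1 + x)^n bounds the binomial coefficient; x = c/(1 - c) makes the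
  terms near k = c n dominant. The remaining ratio y = b/x is below 1, so larger \<open>k\<close>
  only helps, and (1 + x) y^c < 1 is exactly the hypothesis on \<open>b\<close>.\<close>

lemma binomial_term_decay:
  fixes b c :: real
  assumes c: "0 < c" "c < 1" and b: "0 < b" "b < exp ((c * ln c + (1 - c) * ln (1 - c)) / c)"
  shows "\<exists>A \<gamma>. A > 0 \<and> 0 < \<gamma> \<and> \<gamma> < 1 \<and>
    (\<forall>n k. c * real n - 1 \<le> real k \<longrightarrow> real (n choose k) * b ^ k \<le> A * \<gamma> ^ n)"
proof -
  define x where "x = c / (1 - c)"
  have x: "x > 0" using c by (simp add: x_def)
  have lnb: "c * ln b < c * ln c + (1 - c) * ln (1 - c)"
  proof -
    have "ln b < (c * ln c + (1 - c) * ln (1 - c)) / c" using b by (metis ln_exp ln_less_cancel_iff exp_gt_zero)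
    then show ?thesis using c by (simp add: field_simps)
  qed
  define y where "y = b / x"
  have y0: "y > 0" using b x by (simp add: y_def)
  have lny: "ln y = ln b - ln c + ln (1 - c)"
    using b x c by (simp add: y_def x_def ln_div ln_mult)
  have "c * ln y < ln (1 - c)" using lnb c by (simp add: lny algebra_simps)
  moreover have "ln (1 - c) < 0" using c by simp
  ultimately have "c * ln y < 0" by linarith
  then have "ln y < 0" using c by (simp add: mult_less_0_iff)
  then have y1: "y < 1" using y0 by simp
  define \<gamma> where "\<gamma> = (1 + x) * y powr c"
  have x1: "1 + x = 1 / (1 - c)" using c by (simp add: x_def field_simps)
  have \<gamma>0: "\<gamma> > 0" using x y0 by (simp add: \<gamma>_def)
  have "ln \<gamma> = - ln (1 - c) + c * ln y"
    using x y0 c by (simp add: \<gamma>_def ln_mult ln_powr x1 ln_div)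
  then have \<gamma>1: "\<gamma> < 1" using \<gamma>0 \<open>c * ln y < ln (1 - c)\<close> by (metis add.commute diff_less_0_iff_less ln_less_zero_iff uminus_add_conv_diff)
  have "real (n choose k) * b ^ k \<le> (1 / y) * \<gamma> ^ n" if k: "c * real n - 1 \<le> real k" for n k
  proof -
    have "real (n choose k) * x ^ k \<le> (1 + x) ^ n"
    proof (cases "k \<le> n")
      case True
      have "real (n choose k) * x ^ k \<le> (\<Sum>j\<le>n. real (n choose j) * x ^ j)"
        using True x by (intro member_le_sum) auto
      also have "\<dots> = (x + 1) ^ n" by (simp add: binomial_ring)
      finally show ?thesis by (simp add: add.commute)
    next
      case False
      then show ?thesis using x by (simp add: binomial_eq_0)
    qed
    then have "real (n choose k) * x ^ k * y ^ k \<le> (1 + x) ^ n * y ^ k"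
      using y0 by (intro mult_right_mono) auto
    moreover have "x ^ k * y ^ k = b ^ k" using x by (simp add: y_def flip: power_mult_distrib)
    ultimately have "real (n choose k) * b ^ k \<le> (1 + x) ^ n * y ^ k" by (simp add: mult.assoc)
    also have "y ^ k = y powr real k" using y0 by (simp add: powr_realpow)
    \<comment> \<open>The loss of 1 from rounding \<open>k\<close> down becomes the constant factor
      \<open>1 / y\<close>.\<close>
    also have "\<dots> \<le> y powr (c * real n - 1)" using y0 y1 k by (intro powr_mono') auto
    also have "\<dots> = (1 / y) * (y powr c) ^ n"
      using y0 by (simp add: powr_diff powr_powr flip: powr_realpow)
    finally show ?thesis using x by (simp add: \<gamma>_def power_mult_distrib mult_ac mult_left_mono)
  qed
  then show ?thesis using y0 \<gamma>0 \<gamma>1 by (intro exI[of _ "1 / y"] exI[of _ \<gamma>]) auto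
qed

text \<open>For t = c/q the logarithm of the rate is ln(1 - q + c) + c ln(q/c). Bounding both by ln
  z \<le> z - 1, strictly in the second term, gives a total below (c - q) + (q - c) = 0.\<close>

lemma chernoff_decay:
  fixes q c :: real
  assumes "0 < c" "c < q" "q < 1"
  shows "\<exists>t \<gamma>. 0 < t \<and> t \<le> 1 \<and> 0 < \<gamma> \<and> \<gamma> < 1 \<and>
    (\<forall>n k. real k \<le> c * real n \<longrightarrow> (1 - q * (1 - t)) ^ n / t ^ k \<le> 1 * \<gamma> ^ n)"
proof -
  define t where "t = c / q"
  have t: "0 < t" "t < 1" using assms by (simp_all add: t_def)
  have u: "1 - q * (1 - t) = 1 - q + c" using assms by (simp add: t_def algebra_simps)
  have u0: "1 - q + c > 0" using assms by simp
  define \<gamma> where "\<gamma> = (1 - q + c) / t powr c"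
  have \<gamma>0: "\<gamma> > 0" using u0 t by (simp add: \<gamma>_def)
  have "ln \<gamma> = ln (1 - q + c) + c * ln (q / c)"
    using u0 t assms by (simp add: \<gamma>_def ln_div ln_powr t_def algebra_simps)
  also have "ln (1 - q + c) \<le> c - q" using ln_le_minus_one[OF u0] by simp
  also have "c * ln (q / c) < c * (q / c - 1)"
  proof -
    have "q / c > 0" "q / c \<noteq> 1" using assms by auto
    then have "ln (q / c) < q / c - 1"
      using ln_le_minus_one[of "q / c"] ln_eq_minus_one[of "q / c"] by fastforce
    then show ?thesis using assms by simp
  qed
  also have "c * (q / c - 1) = q - c" using assms by (simp add: field_simps)
  finally have "ln \<gamma> < 0" by simp
  then have \<gamma>1: "\<gamma> < 1" using \<gamma>0 by simp
  have "(1 - q * (1 - t)) ^ n / t ^ k \<le> 1 * \<gamma> ^ n" if k: "real k \<le> c * real n" for n k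
  proof -
    have "(t powr c) ^ n = t powr (c * real n)" using t by (simp add: powr_powr flip: powr_realpow)
    also have "\<dots> \<le> t powr real k" using t k by (intro powr_mono') auto
    also have "\<dots> = t ^ k" using t by (simp add: powr_realpow)
    finally have "(1 - q + c) ^ n / t ^ k \<le> (1 - q + c) ^ n / (t powr c) ^ n"
      using t u0 by (intro divide_left_mono) auto
    then show ?thesis by (simp add: u \<gamma>_def power_divide)
  qed
  then show ?thesis using t \<gamma>0 \<gamma>1 by (intro exI[of _ t] exI[of _ \<gamma>]) auto
qed

theorem theorem7p1:
  fixes \<alpha> \<beta> :: real
  assumes "0 \<le> \<beta>" and "\<beta> < 2 powr (- H \<alpha> / \<alpha>)"
    and "2 powr (- H \<alpha> / \<alpha>) < \<alpha>" and "\<alpha> \<le> 1"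
  shows "\<exists>c::real. c \<in> \<rat> \<and> 0 < c \<and> c < \<alpha> \<and>
    (\<exists>C::real. C > 0 \<and>
      (\<forall>(\<epsilon>::real) (n::nat) (r::nat) (d::reg \<Rightarrow> nat) (P0::reg op) (P1::reg op).
         0 < \<epsilon> \<and> \<epsilon> \<le> 1/2 \<and> real n \<ge> C * ln (1/\<epsilon>) \<and> r \<ge> 1 \<and> (\<forall>l. d l > 0) \<and>
         verifier r d P0 P1 \<longrightarrow>
           (p_opt r d P0 P1 \<ge> \<alpha> \<longrightarrow> p_rep n (nat \<lfloor>c * real n\<rfloor>) r d P0 P1 \<ge> 1 - \<epsilon>) \<and>
           (p_opt r d P0 P1 \<le> \<beta> \<longrightarrow> p_rep n (nat \<lfloor>c * real n\<rfloor>) r d P0 P1 \<le> \<epsilon>)))"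
proof -
  have \<alpha>0: "0 < \<alpha>" using assms(3) powr_ge_zero[of 2 "- H \<alpha> / \<alpha>"] by linarith
  \<comment> \<open>At \<alpha> = 1 the entropy is 0 and the third assumption would read 1 <
    1.\<close>
  have "\<alpha> \<noteq> 1" using assms(3) by (auto simp: H_def)
  then have \<alpha>1: "\<alpha> < 1" using assms(4) by simp
  obtain c b where c: "c \<in> \<rat>" "0 < c" "c < \<alpha>" and b: "\<beta> < b" "b < exp ((c * ln c + (1 - c) * ln (1 - c)) / c)"
    using threshold_exists[OF assms(1,2) \<alpha>0 \<alpha>1] by blast
  have "0 < b" "c < 1" using b(1) assms(1) c(3) \<alpha>1 by simp_all
  then obtain A \<gamma> where A: "A > 0" "0 < \<gamma>" "\<gamma> < 1"
    and sound: "\<And>n k. c * real n - 1 \<le> real k \<Longrightarrow> real (n choose k) * b ^ k \<le> A * \<gamma> ^ n"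
    using binomial_term_decay[OF c(2) _ _ b(2)] by blast
  \<comment> \<open>Any value strictly between \<open>c\<close> and \<alpha> works:
    \<open>c < q\<close> gives exponential decay, and \<open>q < \<alpha>\<close> allows a strategy
    that is only nearly optimal.\<close>
  define q where "q = (c + \<alpha>) / 2"
  have q: "c < q" "q < \<alpha>" "q < 1" using c(3) \<alpha>1 by (simp_all add: q_def)
  obtain t \<gamma>' where t: "0 < t" "t \<le> 1" and \<gamma>': "0 < \<gamma>'" "\<gamma>' < 1"
    and complete: "\<And>n k. real k \<le> c * real n \<Longrightarrow> (1 - q * (1 - t)) ^ n / t ^ k \<le> 1 * \<gamma>' ^ n"
    using chernoff_decay[OF c(2) q(1,3)] by blast
  obtain C1 where C1: "C1 > 0"
    "\<And>\<epsilon> n. 0 < \<epsilon> \<Longrightarrow> \<epsilon> \<le> 1/2 \<Longrightarrow> real n \<ge> C1 * ln (1/\<epsilon>) \<Longrightarrow> A * \<gamma> ^ n \<le> \<epsilon>"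
    using exponential_decay_constant[OF A] by blast
  obtain C2 where C2: "C2 > 0"
    "\<And>\<epsilon> n. 0 < \<epsilon> \<Longrightarrow> \<epsilon> \<le> 1/2 \<Longrightarrow> real n \<ge> C2 * ln (1/\<epsilon>) \<Longrightarrow> 1 * \<gamma>' ^ n \<le> \<epsilon>"
    using exponential_decay_constant[OF zero_less_one \<gamma>'] by blast
  define C where "C = max C1 C2"
  have main: "(p_opt r d P0 P1 \<ge> \<alpha> \<longrightarrow> p_rep n (nat \<lfloor>c * real n\<rfloor>) r d P0 P1 \<ge> 1 - \<epsilon>) \<and>
        (p_opt r d P0 P1 \<le> \<beta> \<longrightarrow> p_rep n (nat \<lfloor>c * real n\<rfloor>) r d P0 P1 \<le> \<epsilon>)"
    if asm: "0 < \<epsilon> \<and> \<epsilon> \<le> 1/2 \<and> real n \<ge> C * ln (1/\<epsilon>) \<and> r \<ge> 1 \<and> (\<forall>l. d l > 0) \<and>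
      verifier r d P0 P1" for \<epsilon> n r d P0 P1
  proof (intro conjI impI)
    have \<epsilon>: "0 < \<epsilon>" "\<epsilon> \<le> 1/2" and n: "real n \<ge> C * ln (1/\<epsilon>)" and r: "r \<ge> 1"
      and d: "\<forall>l. d l > 0" and V: "verifier r d P0 P1" using asm by blast+
    let ?k = "nat \<lfloor>c * real n\<rfloor>"
    have "0 \<le> c * real n" using c(2) by simp
    \<comment> \<open>Rounding down is used in both directions: completeness needs \<open>k\<close>
      at most \<open>c * real n\<close>, soundness needs it not much smaller.\<close>
    then have k: "real ?k \<le> c * real n" "c * real n - 1 \<le> real ?k" by linarith+
    have "ln (1/\<epsilon>) \<ge> 0" using \<epsilon> by simp
    then have "C1 * ln (1/\<epsilon>) \<le> C * ln (1/\<epsilon>)" "C2 * ln (1/\<epsilon>) \<le> C * ln (1/\<epsilon>)"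
      by (auto simp: C_def intro: mult_right_mono)
    then have n12: "real n \<ge> C1 * ln (1/\<epsilon>)" "real n \<ge> C2 * ln (1/\<epsilon>)" using n by linarith+
    have d': "d l > 0" for l using d by blast
    show "p_rep n ?k r d P0 P1 \<ge> 1 - \<epsilon>" if "p_opt r d P0 P1 \<ge> \<alpha>"
    proof -
      have "q < p_opt r d P0 P1" using that q(2) by simp
      then have "p_rep n ?k r d P0 P1 \<ge> 1 - (1 - q * (1 - t)) ^ n / t ^ ?k"
        by (rule p_rep_ge[OF V r d' _ t])
      then show ?thesis using complete[OF k(1)] C2(2)[OF \<epsilon> n12(2)] by linarith
    qed
    show "p_rep n ?k r d P0 P1 \<le> \<epsilon>" if "p_opt r d P0 P1 \<le> \<beta>"
    proof -
      have "p_opt r d P0 P1 < b" using that b(1) by simp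
      then have "p_rep n ?k r d P0 P1 \<le> real (n choose ?k) * b ^ ?k"
        by (rule p_rep_le[OF V r d'])
      then show ?thesis using sound[OF k(2)] C1(2)[OF \<epsilon> n12(1)] by linarith
    qed
  qed
  have "C > 0" using C1(1) by (simp add: C_def)
  show ?thesis
    by (rule exI[of _ c], intro conjI c, rule exI[of _ C], intro conjI \<open>C > 0\<close> allI, rule impI, rule main)
qed

end
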